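(* Let $n$ be a positive integer. For $0<r<1$ and $\theta,\nu\in C$ let $$H^{a}_{r}(e^{i\theta},e^{i\nu})=\det\left(\sum_{k\in\mathbb{Z}}e^{i2\pi xk}\,h(\theta_i,\nu_j+2\pi k)\right)_{i,j=1}^{n},\qquad x=\begin{cases}0&\text{if } n \text{ is odd},\\ \tfrac12&\text{if } n\text{ is even},\end{cases}$$ and let $$\tilde H^{a}_{r}(e^{i\theta},e^{i\nu})=\frac{1}{M_{r,\theta}}H^{a}_{r}(e^{i\theta},e^{i\nu}),\qquad M_{r,\theta}=\int_C H^{a}_{r}(e^{i\theta},e^{i\nu})\,d\nu.$$ Then for any $\theta,\nu\in C$, $$\lim_{r\to0}\tilde H^{a}_{r}(e^{i\theta},e^{i\nu})=\frac1M\prod_{1\le i<j\le n}|e^{i\nu_i}-e^{i\nu_j}|,$$ where $$\lim_{r\to0}M_{r,\theta}=M,$$ and $M$ is the corresponding normalisation constant of the right-hand side of the limit above, i.e. $M=\int_C\prod_{1\le i<j\le n}|e^{i\nu_i}-e^{i\nu_j}|\,d\nu$.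
   Context: $C=\tilde A_n\cap\{\nu\in\mathbb{R}^n:-\pi\le\nu_n<\pi\}$, where $\tilde A_n=\{\nu\in\mathbb{R}^n:\nu_n<\nu_{n-1}<\dots<\nu_1<\nu_n+2\pi\}$. The function $h$ (which depends on $r$) is $$h(\theta,\nu)=\frac{1}{2|\log r|}\operatorname{sech}\left(\frac{\pi}{2|\log r|}(\nu-\theta)\right),\qquad \theta,\nu\in\mathbb{R};$$ it is the hitting density on the line $\operatorname{Im}z=|\log r|$ of two-dimensional Brownian motion started at $\theta\in\mathbb{R}$ in the strip $\{0<\operatorname{Im}z<|\log r|\}$ with normal reflection on the real axis and absorption on $\operatorname{Im} z=|\log r|$ (this strip is mapped conformally onto the annulus $\{r<|z|<1\}$, as a covering). The limit $r\to0$ is through $0<r<1$. In $e^{i\theta_j}$, $e^{i\nu_j}$ and $e^{i2\pi xk}$, the $i$ outside of subscripts is the imaginary unit.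
   Formalization: The clause lim M_{r,θ}=M is false for every n (n=1: M_{r,θ}=1, M=2π; n≥2: M_{r,θ}→0<M); proved instead is M_{r,θ}/c(r,θ)→M with c=(2π)^{-n} ∏_{k=1}^n sech((k-(n+1)/2)|log r|) ∏_{i<j}|e^{iθ_i}-e^{iθ_j}|. *)

theory Defs
  imports "HOL-Analysis.Analysis" "Jordan_Normal_Form.Determinant"
begin

text \<open>
  Points of \<open>\<real>\<^sup>n\<close> are extensional functions on \<open>{1..n}\<close>, so that their coordinates are numbered
  as in the source and Lebesgue measure on \<open>\<real>\<^sup>n\<close> is a finite product measure.
\<close>

abbreviation RR :: "nat \<Rightarrow> (nat \<Rightarrow> real) set" where
  "RR n \<equiv> {1..n} \<rightarrow>\<^sub>E UNIV"

definition leb :: "nat \<Rightarrow> (nat \<Rightarrow> real) measure" where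
  "leb n = Pi\<^sub>M {1..n} (\<lambda>_. lborel)"

definition alcove :: "nat \<Rightarrow> (nat \<Rightarrow> real) set" where
  "alcove n = {\<nu> \<in> RR n. (\<forall>i\<in>{1..<n}. \<nu> (Suc i) < \<nu> i) \<and> \<nu> 1 < \<nu> n + 2 * pi}"

definition chamber :: "nat \<Rightarrow> (nat \<Rightarrow> real) set" where
  "chamber n = alcove n \<inter> {\<nu>. - pi \<le> \<nu> n \<and> \<nu> n < pi}"

definition sech :: "real \<Rightarrow> real" where
  "sech x = 1 / cosh x"

definition h :: "real \<Rightarrow> real \<Rightarrow> real \<Rightarrow> real" where
  "h r \<theta> \<nu> = 1 / (2 * \<bar>ln r\<bar>) * sech (pi / (2 * \<bar>ln r\<bar>) * (\<nu> - \<theta>))"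

definition twist :: "nat \<Rightarrow> real" where
  "twist n = (if odd n then 0 else 1 / 2)"

text \<open>
  The points \<open>e\<^sup>i\<^sup>\<theta>\<close>, \<open>e\<^sup>i\<^sup>\<nu>\<close> enter through their representatives \<open>\<theta>, \<nu>\<close> in the chamber. For even \<open>n\<close> the
  choice matters: the entries change sign when a coordinate is shifted by \<open>2\<pi>\<close>. Matrix indices
  start from 0, whence the successors.
\<close>

definition H :: "nat \<Rightarrow> real \<Rightarrow> (nat \<Rightarrow> real) \<Rightarrow> (nat \<Rightarrow> real) \<Rightarrow> complex" where
  "H n r \<theta> \<nu> = Determinant.det (Matrix.mat n n (\<lambda>(i, j).
     \<Sum>\<^sub>\<infinity>k\<in>(UNIV :: int set). exp (\<i> * complex_of_real (2 * pi * twist n * real_of_int k)) *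
       complex_of_real (h r (\<theta> (Suc i)) (\<nu> (Suc j) + 2 * pi * real_of_int k))))"

definition mass :: "nat \<Rightarrow> real \<Rightarrow> (nat \<Rightarrow> real) \<Rightarrow> complex" where
  "mass n r \<theta> = (LINT \<nu>:chamber n|leb n. H n r \<theta> \<nu>)"

definition H_normalised :: "nat \<Rightarrow> real \<Rightarrow> (nat \<Rightarrow> real) \<Rightarrow> (nat \<Rightarrow> real) \<Rightarrow> complex" where
  "H_normalised n r \<theta> \<nu> = 1 / mass n r \<theta> * H n r \<theta> \<nu>"

definition vandermonde_abs :: "nat \<Rightarrow> (nat \<Rightarrow> real) \<Rightarrow> real" where
  "vandermonde_abs n \<nu> =
     (\<Prod>(i, j)\<in>{(i, j). 1 \<le> i \<and> i < j \<and> j \<le> n}. cmod (cis (\<nu> i) - cis (\<nu> j)))"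

definition limit_mass :: "nat \<Rightarrow> real" where
  "limit_mass n = (LINT \<nu>:chamber n|leb n. vandermonde_abs n \<nu>)"

text \<open>
  The factor, independent of \<open>\<nu>\<close>, by which \<open>H\<close> is asymptotic to \<open>vandermonde_abs n \<nu>\<close>. By Poisson
  summation the entries of \<open>H\<close> are
  \<open>(1 / 2\<pi>) \<Sum>m. sech (m |log r|) exp (i m (\<nu>\<^sub>j - \<theta>\<^sub>i))\<close>, with \<open>m\<close> over the integers for odd \<open>n\<close> and over
  the half-odd-integers for even \<open>n\<close>; the \<open>n\<close> frequencies of smallest modulus, \<open>m = k - (n + 1) / 2\<close> with
  \<open>k = 1, \<dots>, n\<close>, dominate the determinant as \<open>r\<close> tends to 0. This factor tends to \<open>1 / 2\<pi>\<close> if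
  \<open>n = 1\<close> and to 0 if \<open>n \<ge> 2\<close>, so \<open>mass\<close> tends to \<open>limit_mass\<close> only after division by it.
\<close>

definition leading_factor :: "nat \<Rightarrow> real \<Rightarrow> (nat \<Rightarrow> real) \<Rightarrow> real" where
  "leading_factor n r \<theta> =
     (1 / (2 * pi)) ^ n * (\<Prod>k = 1..n. sech ((real k - (real n + 1) / 2) * \<bar>ln r\<bar>)) *
     vandermonde_abs n \<theta>"

end

theory Submission
  imports Defs "HOL-Complex_Analysis.Complex_Analysis"
begin

text \<open>
  Write \<open>L = |ln r|\<close>. The entries of the matrix defining \<open>H\<close> are the values at \<open>\<nu>\<^sub>j - \<theta>\<^sub>i\<close> of a (twisted)
  periodization of a hyperbolic secant, and hyperbolic secants are self-dual under the Fourier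
  transform. Poisson summation (\<open>poisson_summation_sech\<close>, \<open>entry_eq_kernel\<close>) therefore gives
  \<open>(1 / 2\<pi>) \<Sum>\<^sub>m sech (m L) exp (i m (\<nu>\<^sub>j - \<theta>\<^sub>i))\<close>, where the frequencies \<open>m\<close> are the numbers
  \<open>k - (n + 1) / 2\<close> for integers \<open>k\<close>: this is the role of the twist, which makes the frequency
  set symmetric and the window \<open>k = 1, \<dots>, n\<close> of the \<open>n\<close> smallest moduli unique.

  Expanding the determinant in its rows turns it into a sum over assignments of one frequency to
  each row. Assignments that repeat a frequency contribute nothing. Among the others, the weight
  \<open>\<Prod> sech (m L)\<close> is of order \<open>exp (- L \<Sum> |m|)\<close>, and \<open>\<Sum> |m|\<close> exceeds its minimum by at least 1 unless
  exactly the window \<open>k = 1, \<dots>, n\<close> is used (\<open>freq_sum_gap\<close>). Hence, uniformly in \<open>\<nu>\<close> and up to a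
  relative error \<open>O(exp (- L)) = O(r)\<close>, the determinant is that of the finite matrix built from the
  window (\<open>det_infinite_minus_truncated\<close>). The latter factorizes (\<open>det_truncated\<close>) into the weight
  of the window and two Vandermonde determinants, one in \<open>\<theta>\<close> and conjugated, one in \<open>\<nu>\<close>. On the alcove
  a Vandermonde determinant of the centred exponentials is its modulus times a constant phase
  (\<open>det_exponentials\<close>), and the two phases cancel. This gives \<open>H_asymptotics\<close>: the quotient
  \<open>H / leading_factor\<close> tends to \<open>vandermonde_abs\<close> with error at most \<open>C r\<close>. The chamber has finite
  positive measure, so the estimate can be integrated, and both limits follow.

  Poisson summation is proved without Fourier integrals. Let \<open>D\<close> be the difference of the two sides,
  continued analytically to the strip \<open>- L < Im z < 3 L\<close>. Their poles at \<open>i L + 2 \<pi> k\<close> cancel, a shift by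
  \<open>2 \<pi>\<close> multiplies \<open>D\<close> by a number of modulus 1, and a shift by \<open>2 i L\<close> changes its sign. So \<open>|D|\<close> is
  doubly periodic, attains its maximum inside the strip, and \<open>D\<close> is constant by the maximum
  modulus principle; the sign change forces the constant to be 0.
\<close>

section \<open>Infinite sums of holomorphic functions and exponential series\<close>

text \<open>
  The Weierstrass M-test over an arbitrary index set, with the dominating sum chosen locally.
\<close>

lemma holomorphic_on_infsum:
  fixes f :: "'k \<Rightarrow> complex \<Rightarrow> complex"
  assumes "open S"
    and holo: "\<And>k. k \<in> K \<Longrightarrow> f k holomorphic_on S"
    and dom: "\<And>z. z \<in> S \<Longrightarrow>
      \<exists>r>0. \<exists>M. M summable_on K \<and> (\<forall>k\<in>K. \<forall>w\<in>cball z r \<inter> S. norm (f k w) \<le> M k)"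
  shows "(\<lambda>z. \<Sum>\<^sub>\<infinity>k\<in>K. f k z) holomorphic_on S"
proof -
  have "\<exists>r>0. (\<lambda>z. \<Sum>\<^sub>\<infinity>k\<in>K. f k z) holomorphic_on ball z r" if z: "z \<in> S" for z
  proof -
    obtain r M where r: "r > 0" and M: "M summable_on K"
      and bd: "\<And>k w. k \<in> K \<Longrightarrow> w \<in> cball z r \<inter> S \<Longrightarrow> norm (f k w) \<le> M k"
      using dom[OF z] by blast
    obtain e where e: "e > 0" "cball z e \<subseteq> S"
      using z \<open>open S\<close> open_contains_cball by blast
    define d where "d = min r e"
    have d: "d > 0" "cball z d \<subseteq> cball z r \<inter> S"
      using r e by (auto simp: d_def)
    have ul: "uniform_limit (cball z d) (\<lambda>X y. \<Sum>x\<in>X. f x y) (\<lambda>y. \<Sum>\<^sub>\<infinity>x\<in>K. f x y)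
                (finite_subsets_at_top K)"
      by (rule Weierstrass_m_test_general[OF _ M]) (use bd d in blast)
    have ev: "\<forall>\<^sub>F X in finite_subsets_at_top K.
        continuous_on (cball z d) (\<lambda>y. \<Sum>x\<in>X. f x y) \<and> (\<lambda>y. \<Sum>x\<in>X. f x y) holomorphic_on ball z d"
    proof (rule eventually_finite_subsets_at_top_weakI)
      fix X assume "finite X" "X \<subseteq> K"
      then have "(\<lambda>y. \<Sum>x\<in>X. f x y) holomorphic_on S"
        by (intro holomorphic_on_sum holo) auto
      then show "continuous_on (cball z d) (\<lambda>y. \<Sum>x\<in>X. f x y) \<and>
          (\<lambda>y. \<Sum>x\<in>X. f x y) holomorphic_on ball z d"
        using d ball_subset_cball[of z d]
        by (meson holomorphic_on_imp_continuous_on holomorphic_on_subset le_inf_iff order_trans)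
    qed
    show ?thesis
      using holomorphic_uniform_limit[OF ev ul] d by auto
  qed
  then obtain r where r: "\<And>z. z \<in> S \<Longrightarrow> r z > 0"
    "\<And>z. z \<in> S \<Longrightarrow> (\<lambda>z. \<Sum>\<^sub>\<infinity>k\<in>K. f k z) holomorphic_on ball z (r z)"
    by metis
  show ?thesis
    unfolding holomorphic_on_def
  proof
    fix z assume z: "z \<in> S"
    have "(\<lambda>z. \<Sum>\<^sub>\<infinity>k\<in>K. f k z) field_differentiable at z"
      using r[OF z] by (simp add: holomorphic_on_imp_differentiable_at)
    then show "(\<lambda>z. \<Sum>\<^sub>\<infinity>k\<in>K. f k z) field_differentiable at z within S"
      by (rule field_differentiable_at_within)
  qed
qed

text \<open>
  Pairs the integer \<open>j\<close> with the natural number \<open>j\<close> for \<open>j \<ge> 0\<close> and with \<open>- j - 1\<close> for \<open>j < 0\<close>,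
  so that a sum over the integers is handled as two one-sided series.
\<close>

lemma has_sum_int_split:
  fixes f :: "int \<Rightarrow> 'a :: {comm_monoid_add, topological_comm_monoid_add}"
  assumes "((\<lambda>j. f (int j)) has_sum s) UNIV" and "((\<lambda>j. f (- int j - 1)) has_sum t) UNIV"
  shows "(f has_sum (s + t)) UNIV"
proof -
  have 1: "bij_betw int UNIV {0..}"
    by (rule bij_betwI[of _ _ _ nat]) auto
  have 2: "bij_betw (\<lambda>j. - int j - 1) UNIV {..<0}"
    by (rule bij_betwI[of _ _ _ "\<lambda>k. nat (- k - 1)"]) auto
  have "(f has_sum s) {0..}" "(f has_sum t) {..<0}"
    using assms has_sum_reindex_bij_betw[OF 1, of f s] has_sum_reindex_bij_betw[OF 2, of f t]
    by simp_all
  then have "(f has_sum (s + t)) ({0..} \<union> {..<0})"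
    by (rule has_sum_Un_disjoint) auto
  moreover have "{0..} \<union> {..<0} = (UNIV :: int set)"
    by auto
  ultimately show ?thesis
    by simp
qed

lemma summable_on_exp_nat:
  assumes "(d::real) > 0"
  shows "(\<lambda>j. exp (- (d * real j))) summable_on UNIV"
proof -
  have "exp (- (d * real j)) = exp (- d) ^ j" for j
    by (simp add: exp_of_nat_mult[symmetric] mult.commute)
  then have "summable (\<lambda>j. norm (exp (- (d * real j))))"
    using assms by (simp add: summable_geometric)
  then show ?thesis
    by (rule norm_summable_imp_summable_on)
qed

lemma summable_on_exp_abs_int:
  assumes "(d::real) > 0"
  shows "(\<lambda>k. exp (- (d * \<bar>real_of_int k + c\<bar>))) summable_on UNIV"
proof -
  have *: "(\<lambda>k. exp (- (d * \<bar>real_of_int k\<bar>))) summable_on UNIV"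
  proof -
    obtain s where s: "((\<lambda>j. exp (- (d * real j))) has_sum s) UNIV"
      using summable_on_exp_nat[OF assms] unfolding summable_on_def by blast
    have "((\<lambda>j. exp (- d) * exp (- (d * real j))) has_sum (exp (- d) * s)) UNIV"
      using s by (rule has_sum_cmult_right)
    then have "((\<lambda>j. exp (- (d * \<bar>real_of_int (- int j - 1)\<bar>))) has_sum (exp (- d) * s)) UNIV"
      by (simp add: algebra_simps exp_add[symmetric] exp_diff abs_if exp_minus divide_simps)
    with s have "((\<lambda>k. exp (- (d * \<bar>real_of_int k\<bar>))) has_sum (s + exp (- d) * s)) UNIV"
      by (intro has_sum_int_split) simp_all
    then show ?thesis
      unfolding summable_on_def by blast
  qed
  have "(\<lambda>k. exp (d * \<bar>c\<bar>) * exp (- (d * \<bar>real_of_int k\<bar>))) summable_on UNIV"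
    by (rule summable_on_cmult_right[OF *])
  then show ?thesis
  proof (rule summable_on_comparison_test)
    fix k :: int
    have "\<bar>real_of_int k\<bar> \<le> \<bar>real_of_int k + c\<bar> + \<bar>c\<bar>"
      by linarith
    then have "d * \<bar>real_of_int k\<bar> \<le> d * (\<bar>real_of_int k + c\<bar> + \<bar>c\<bar>)"
      using assms by simp
    then have "exp (- (d * \<bar>real_of_int k + c\<bar>)) \<le> exp (d * \<bar>c\<bar> + - (d * \<bar>real_of_int k\<bar>))"
      by (simp add: algebra_simps)
    then show "exp (- (d * \<bar>real_of_int k + c\<bar>)) \<le> exp (d * \<bar>c\<bar>) * exp (- (d * \<bar>real_of_int k\<bar>))"
      by (simp only: exp_add)
  qed simp
qed

text \<open>
  A coefficient of size \<open>exp (- p R)\<close> beats the growth of \<open>exp (i p w)\<close> exactly on the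
  half-plane \<open>Im w > - R\<close>, with a geometric gain that is uniform on smaller half-planes.
\<close>

lemma norm_exp_series_le:
  assumes "p \<ge> real j" "norm c \<le> 2 * exp (- (p * R))" "Im w + R \<ge> d" "d > 0"
  shows "norm (c * exp (\<i> * of_real p * w)) \<le> 2 * exp (- (d * real j))"
proof -
  have "norm (c * exp (\<i> * of_real p * w)) = norm c * exp (- (p * Im w))"
    by (simp add: norm_mult)
  also have "\<dots> \<le> 2 * exp (- (p * R)) * exp (- (p * Im w))"
    using assms by (intro mult_right_mono) auto
  also have "\<dots> = 2 * exp (- (p * (Im w + R)))"
    by (simp add: exp_add[symmetric] algebra_simps)
  also have "\<dots> \<le> 2 * exp (- (real j * d))"
  proof -
    have "real j * d \<le> p * (Im w + R)"
      using assms by (intro mult_mono) auto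
    then show ?thesis by simp
  qed
  finally show ?thesis by (simp add: mult.commute)
qed

lemma abs_summable_exp_series:
  assumes "s \<ge> 0" "\<And>j. norm (c j) \<le> 2 * exp (- ((real j + s) * R))" "Im z > - R"
  shows "(\<lambda>j. norm (c j * exp (\<i> * of_real (real j + s) * z))) summable_on UNIV"
proof (rule summable_on_comparison_test)
  show "(\<lambda>j. 2 * exp (- ((Im z + R) * real j))) summable_on UNIV"
    using assms by (intro summable_on_cmult_right summable_on_exp_nat) auto
  show "norm (c j * exp (\<i> * of_real (real j + s) * z)) \<le> 2 * exp (- ((Im z + R) * real j))" for j
    using assms by (intro norm_exp_series_le) auto
qed auto

lemma holomorphic_on_exp_series:
  assumes "s \<ge> 0" "\<And>j. norm (c j) \<le> 2 * exp (- ((real j + s) * R))"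
  shows "(\<lambda>z. \<Sum>\<^sub>\<infinity>j. c j * exp (\<i> * of_real (real j + s) * z)) holomorphic_on {z. Im z > - R}"
proof (rule holomorphic_on_infsum)
  show "open {z. Im z > - R}"
    by (simp add: open_halfspace_Im_gt)
  fix z assume "z \<in> {z. Im z > - R}"
  then have z: "Im z + R > 0" by simp
  define d where "d = (Im z + R) / 2"
  show "\<exists>r>0. \<exists>M. M summable_on UNIV \<and> (\<forall>j\<in>UNIV. \<forall>w\<in>cball z r \<inter> {z. Im z > - R}.
      norm (c j * exp (\<i> * of_real (real j + s) * w)) \<le> M j)"
  proof (intro exI conjI ballI)
    show "d > 0" using z by (simp add: d_def)
    then show "(\<lambda>j. 2 * exp (- (d * real j))) summable_on UNIV"
      by (intro summable_on_cmult_right summable_on_exp_nat)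
    fix j w assume "w \<in> cball z d \<inter> {z. Im z > - R}"
    then have "\<bar>Im z - Im w\<bar> \<le> d"
      using abs_Im_le_cmod[of "z - w"] by (simp add: dist_norm)
    then have "Im w + R \<ge> d" by (simp add: d_def abs_if split: if_splits)
    then show "norm (c j * exp (\<i> * of_real (real j + s) * w)) \<le> 2 * exp (- (d * real j))"
      using assms \<open>d > 0\<close> by (intro norm_exp_series_le) auto
  qed
qed (intro holomorphic_intros)

lemma inverse_cosh_le: "1 / cosh (x::real) \<le> 2 * exp (- x)"
proof -
  have "1 / cosh x \<le> 1 / (exp x / 2)"
    by (rule frac_le) (auto simp: cosh_def)
  then show ?thesis
    by (simp add: exp_minus divide_simps)
qed

text \<open>
  Away from the imaginary axis the hyperbolic cosine has no zeros; this bound makes it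
  quantitative, since \<open>|cosh z|\<close> is at least half the difference of \<open>|exp z|\<close> and \<open>|exp (-
  z)|\<close>.
\<close>

lemma norm_cosh_ge:
  fixes z :: complex
  shows "norm (cosh z) \<ge> \<bar>sinh (Re z)\<bar>"
proof -
  have "norm (cosh z) \<ge> \<bar>norm (exp z) - norm (exp (- z))\<bar> / 2"
    using norm_triangle_ineq3[of "exp z" "- exp (- z)"]
    by (simp add: cosh_def norm_divide)
  then show ?thesis
    by (simp add: sinh_def)
qed

lemma cosh_eq_0_in_strip:
  fixes z :: complex
  assumes "cosh z = 0" "- pi / 2 < Im z" "Im z < 3 * pi / 2"
  shows "z = \<i> * of_real (pi / 2)"
proof -
  have "Re z = 0"
    using norm_cosh_ge[of z] assms(1) sinh_real_zero_iff[of "Re z"] by simp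
  then have z: "z = \<i> * of_real (Im z)"
    by (simp add: complex_eq_iff)
  have "cosh z = of_real (cos (Im z))"
    by (subst z) (simp add: cosh_conv_cos cos_of_real)
  with assms(1) have "cos (Im z) = 0" by (metis of_real_eq_0_iff)
  then have "cos (Im z - pi) = 0" by simp
  have "Im z = pi / 2"
  proof (rule ccontr)
    assume ne: "Im z \<noteq> pi / 2"
    show False
    proof (cases "Im z < pi / 2")
      case True
      then show ?thesis using cos_gt_zero_pi[of "Im z"] assms \<open>cos (Im z) = 0\<close> by simp
    next
      case False
      then show ?thesis using cos_gt_zero_pi[of "Im z - pi"] assms ne \<open>cos (Im z - pi) = 0\<close> by simp
    qed
  qed
  with z show ?thesis by simp
qed

text \<open>
  Computes the residue of \<open>1 / f\<close> at a simple zero of \<open>f\<close>.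
\<close>

lemma tendsto_div_simple_zero:
  fixes f :: "complex \<Rightarrow> complex"
  assumes "(f has_field_derivative d) (at a)" "f a = 0" "d \<noteq> 0"
  shows "((\<lambda>z. (z - a) / f z) \<longlongrightarrow> 1 / d) (at a)"
proof -
  have "((\<lambda>z. (f z - f a) / (z - a)) \<longlongrightarrow> d) (at a)"
    using assms(1) by (simp add: has_field_derivative_iff)
  then have "((\<lambda>z. inverse ((f z - f a) / (z - a))) \<longlongrightarrow> inverse d) (at a)"
    using assms(3) by (rule tendsto_inverse)
  then show ?thesis
    using assms(2) by (simp add: inverse_eq_divide)
qed

section \<open>Continuation of the Fourier series of the periodized hyperbolic secant\<close>

text \<open>
  The analytic continuation of the density \<open>h r 0\<close>, for \<open>L = |ln r|\<close>.
\<close>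

definition sech_density :: "real \<Rightarrow> complex \<Rightarrow> complex" where
  "sech_density L z = 1 / (2 * of_real L * cosh (of_real (pi / (2 * L)) * z))"

text \<open>
  The twist enters as \<open>exp (- 2 \<pi> i y k)\<close>, so that the sum is multiplied by \<open>exp (2 \<pi> i y)\<close>
  under the shift by \<open>2 \<pi>\<close>, as are the exponentials of frequency in \<open>y + \<int>\<close>.
\<close>

definition twisted_sum :: "real \<Rightarrow> real \<Rightarrow> complex \<Rightarrow> complex" where
  "twisted_sum L y z = (\<Sum>\<^sub>\<infinity>k\<in>(UNIV :: int set).
     exp (- (\<i> * of_real (2 * pi * y * of_int k))) * sech_density L (z + of_real (2 * pi * of_int k)))"

text \<open>
  The part of the Fourier series \<open>\<Sum> sech (m L) exp (i m z)\<close> over the frequencies \<open>m = j +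
  y > 0\<close>. It converges for \<open>Im z > - L\<close>.
\<close>

definition upper_series :: "real \<Rightarrow> real \<Rightarrow> complex \<Rightarrow> complex" where
  "upper_series L y z =
     (\<Sum>\<^sub>\<infinity>j. of_real (1 / cosh ((real j + y) * L)) * exp (\<i> * of_real (real j + y) * z))"

text \<open>
  The frequencies \<open>m = - (j + (1 - y)) \<le> 0\<close> give a series that converges only for \<open>Im z < L\<close>.
  Writing \<open>sech x = 2 exp (- x) - exp (- 2 x) sech x\<close> splits it into a geometric series, which
  sums to the meromorphic function \<open>lower_pole\<close>, minus this remainder, which converges for \<open>Im
  z < 3 L\<close>.
\<close>

definition lower_rest :: "real \<Rightarrow> real \<Rightarrow> complex \<Rightarrow> complex" where
  "lower_rest L y z =
     (\<Sum>\<^sub>\<infinity>j. of_real (exp (- (2 * ((real j + (1 - y)) * L))) / cosh ((real j + (1 - y)) * L)) *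
            exp (\<i> * of_real (real j + (1 - y)) * (- z)))"

definition lower_pole :: "real \<Rightarrow> real \<Rightarrow> complex \<Rightarrow> complex" where
  "lower_pole L y z = 2 * exp (- (of_real (1 - y) * (of_real L + \<i> * z))) / (1 - exp (- (of_real L + \<i> * z)))"

definition fourier_side :: "real \<Rightarrow> real \<Rightarrow> complex \<Rightarrow> complex" where
  "fourier_side L y z = (upper_series L y z + lower_pole L y z - lower_rest L y z) / (2 * pi)"

lemma twisted_sum_shift_period:
  "twisted_sum L y (z + of_real (2 * pi * of_int k)) = exp (\<i> * of_real (2 * pi * y * of_int k)) * twisted_sum L y z"
proof -
  have "twisted_sum L y (z + of_real (2 * pi * of_int k)) =
    (\<Sum>\<^sub>\<infinity>l\<in>UNIV. exp (\<i> * of_real (2 * pi * y * of_int k)) *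
      (exp (- (\<i> * of_real (2 * pi * y * of_int (l + k)))) * sech_density L (z + of_real (2 * pi * of_int (l + k)))))"
    unfolding twisted_sum_def
    by (intro infsum_cong) (simp add: algebra_simps exp_add[symmetric])
  also have "\<dots> = (\<Sum>\<^sub>\<infinity>l\<in>UNIV. exp (\<i> * of_real (2 * pi * y * of_int k)) *
      (exp (- (\<i> * of_real (2 * pi * y * of_int l))) * sech_density L (z + of_real (2 * pi * of_int l))))"
    by (rule infsum_reindex_bij_betw[where g = "\<lambda>l. l + k"])
       (rule bij_betwI[of _ _ _ "\<lambda>l. l - k"], auto)
  finally show ?thesis
    by (simp add: infsum_cmult_right' twisted_sum_def)
qed

lemma twisted_sum_shift_imaginary:
  assumes "L > 0"
  shows "twisted_sum L y (z + 2 * \<i> * of_real L) = - twisted_sum L y z"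
proof -
  have "sech_density L (w + 2 * \<i> * of_real L) = - sech_density L w" for w
  proof -
    have "of_real (pi / (2 * L)) * (w + 2 * \<i> * of_real L) = of_real (pi / (2 * L)) * w + \<i> * of_real pi"
      using assms by (simp add: field_simps)
    moreover have "cosh (u + \<i> * of_real pi) = - cosh u" for u :: complex
      by (simp add: cosh_def exp_add exp_diff exp_minus scaleR_conv_of_real field_simps)
    ultimately show ?thesis
      by (simp add: sech_density_def)
  qed
  from this[of "z + of_real (2 * pi * of_int k)" for k] show ?thesis
    by (simp add: twisted_sum_def infsum_uminus add_ac)
qed

lemma has_sum_geometric_exp:
  fixes w :: complex
  assumes "Re w > 0"
  shows "((\<lambda>j. 2 * exp (- (of_real (real j + s) * w))) has_sum (2 * exp (- (of_real s * w)) / (1 - exp (- w)))) UNIV"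
proof -
  have n: "norm (exp (- w)) < 1"
    using assms by simp
  have "((\<lambda>j. exp (- w) ^ j) has_sum (1 / (1 - exp (- w)))) UNIV"
    using geometric_sums[OF n] n
    by (intro norm_summable_imp_has_sum) (auto simp: norm_power summable_geometric)
  then have "((\<lambda>j. 2 * exp (- (of_real s * w)) * exp (- w) ^ j) has_sum
      (2 * exp (- (of_real s * w)) * (1 / (1 - exp (- w))))) UNIV"
    by (rule has_sum_cmult_right)
  moreover have "2 * exp (- (of_real s * w)) * exp (- w) ^ j = 2 * exp (- (of_real (real j + s) * w))" for j
    by (simp add: exp_of_nat_mult[symmetric] exp_add[symmetric] algebra_simps)
  ultimately show ?thesis
    by simp
qed

text \<open>
  This is where the hyperbolic secant matters: its coefficients at heights \<open>z\<close> and \<open>z + 2 i L\<close>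
  add up to a pure geometric series.
\<close>

lemma exp_over_cosh_identity:
  "exp (- (2 * x)) / cosh x + 1 / cosh x = 2 * exp (- (x :: real))"
proof -
  have "exp (- (2 * x)) + 1 = 2 * exp (- x) * cosh x"
    by (simp add: cosh_def algebra_simps exp_add[symmetric])
  then show ?thesis
    by (simp add: add_divide_distrib[symmetric])
qed

lemma upper_coeff_bound:
  "norm (complex_of_real (1 / cosh ((real j + s) * L))) \<le> 2 * exp (- ((real j + s) * L))"
  using inverse_cosh_le[of "(real j + s) * L"] by (simp add: norm_divide)

lemma lower_coeff_bound:
  "norm (complex_of_real (exp (- (2 * ((real j + s) * L))) / cosh ((real j + s) * L)))
     \<le> 2 * exp (- ((real j + s) * (3 * L)))"
proof -
  have "exp (- (2 * ((real j + s) * L))) * (1 / cosh ((real j + s) * L)) \<le>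
      exp (- (2 * ((real j + s) * L))) * (2 * exp (- ((real j + s) * L)))"
    by (intro mult_left_mono inverse_cosh_le) auto
  also have "\<dots> = 2 * exp (- ((real j + s) * (3 * L)))"
    by (simp add: exp_add[symmetric] algebra_simps)
  finally show ?thesis
    by (simp add: norm_divide)
qed

context
  fixes L y :: real
  assumes L: "L > 0" and y: "0 < y" "y \<le> 1"
begin

lemma upper_series_has_sum:
  assumes "Im z > - L"
  shows "((\<lambda>j. of_real (1 / cosh ((real j + y) * L)) * exp (\<i> * of_real (real j + y) * z))
     has_sum upper_series L y z) UNIV"
  unfolding upper_series_def
proof (rule has_sum_infsum, rule abs_summable_summable)
  show "(\<lambda>j. norm (of_real (1 / cosh ((real j + y) * L)) * exp (\<i> * of_real (real j + y) * z)))
     summable_on UNIV"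
  proof (rule abs_summable_exp_series[where R = L and c = "\<lambda>j. of_real (1 / cosh ((real j + y) * L))"])
    show "norm (complex_of_real (1 / cosh ((real j + y) * L))) \<le> 2 * exp (- ((real j + y) * L))" for j
      by (rule upper_coeff_bound)
  qed (use y(1) assms in simp_all)
qed

lemma lower_rest_has_sum:
  assumes "Im z < 3 * L"
  shows "((\<lambda>j. of_real (exp (- (2 * ((real j + (1 - y)) * L))) / cosh ((real j + (1 - y)) * L)) *
            exp (\<i> * of_real (real j + (1 - y)) * (- z))) has_sum lower_rest L y z) UNIV"
  unfolding lower_rest_def
proof (rule has_sum_infsum, rule abs_summable_summable)
  show "(\<lambda>j. norm (of_real (exp (- (2 * ((real j + (1 - y)) * L))) / cosh ((real j + (1 - y)) * L)) *
            exp (\<i> * of_real (real j + (1 - y)) * (- z)))) summable_on UNIV"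
  proof (rule abs_summable_exp_series[where R = "3 * L" and
        c = "\<lambda>j. of_real (exp (- (2 * ((real j + (1 - y)) * L))) / cosh ((real j + (1 - y)) * L))"])
    show "norm (complex_of_real (exp (- (2 * ((real j + (1 - y)) * L))) / cosh ((real j + (1 - y)) * L)))
        \<le> 2 * exp (- ((real j + (1 - y)) * (3 * L)))" for j
      by (rule lower_coeff_bound)
  qed (use y(2) assms in simp_all)
qed

text \<open>
  On \<open>Im z < L\<close> the continuation \<open>lower_pole - lower_rest\<close> agrees with the original series over
  the nonpositive frequencies.
\<close>

lemma lower_series_has_sum:
  assumes "Im z < L"
  shows "((\<lambda>j. of_real (1 / cosh ((real j + (1 - y)) * L)) * exp (\<i> * of_real (real j + (1 - y)) * (- z)))
     has_sum (lower_pole L y z - lower_rest L y z)) UNIV"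
proof -
  let ?p = "\<lambda>j. real j + (1 - y)"
  have "((\<lambda>j. 2 * exp (- (of_real (?p j) * (of_real L + \<i> * z)))) has_sum lower_pole L y z) UNIV"
    unfolding lower_pole_def using assms by (intro has_sum_geometric_exp) auto
  then have "((\<lambda>j. 2 * exp (- (of_real (?p j) * (of_real L + \<i> * z))) -
      of_real (exp (- (2 * (?p j * L))) / cosh (?p j * L)) * exp (\<i> * of_real (?p j) * (- z)))
      has_sum (lower_pole L y z - lower_rest L y z)) UNIV"
    using has_sum_add[OF _ has_sum_uminusI[OF lower_rest_has_sum[of z]]] assms L by fastforce
  moreover have split: "x - of_real u * w = of_real v * w" if "x = of_real (u + v) * w" for x w :: complex and u v
    using that by (simp add: algebra_simps)
  have "2 * exp (- (of_real (?p j) * (of_real L + \<i> * z))) -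
      of_real (exp (- (2 * (?p j * L))) / cosh (?p j * L)) * exp (\<i> * of_real (?p j) * (- z))
      = of_real (1 / cosh (?p j * L)) * exp (\<i> * of_real (?p j) * (- z))" for j
  proof -
    have "- (of_real (?p j) * (of_real L + \<i> * z)) = of_real (- (?p j * L)) + \<i> * of_real (?p j) * (- z)"
      by (simp add: algebra_simps)
    then have "exp (- (of_real (?p j) * (of_real L + \<i> * z))) =
        of_real (exp (- (?p j * L))) * exp (\<i> * of_real (?p j) * (- z))"
      by (simp only: exp_add exp_of_real)
    then have "2 * exp (- (of_real (?p j) * (of_real L + \<i> * z))) =
       of_real (2 * exp (- (?p j * L))) * exp (\<i> * of_real (?p j) * (- z))"
      by simp
    also have "\<dots> = of_real (exp (- (2 * (?p j * L))) / cosh (?p j * L) + 1 / cosh (?p j * L))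
        * exp (\<i> * of_real (?p j) * (- z))"
      by (simp only: exp_over_cosh_identity)
    finally show ?thesis
      by (rule split)
  qed
  ultimately show ?thesis
    by simp
qed

lemma fourier_side_has_sum:
  assumes "\<bar>Im z\<bar> < L"
  shows "((\<lambda>k. 1 / (2 * pi) * (of_real (1 / cosh ((real_of_int k + y) * L)) * exp (\<i> * of_real (real_of_int k + y) * z)))
     has_sum fourier_side L y z) UNIV"
proof -
  have e: "real_of_int (- int j - 1) + y = - (real j + (1 - y))" for j
    by simp
  have "((\<lambda>k. of_real (1 / cosh ((real_of_int k + y) * L)) * exp (\<i> * of_real (real_of_int k + y) * z))
     has_sum (upper_series L y z + (lower_pole L y z - lower_rest L y z))) UNIV"
  proof (rule has_sum_int_split)
    show "((\<lambda>j. of_real (1 / cosh ((real_of_int (int j) + y) * L)) * exp (\<i> * of_real (real_of_int (int j) + y) * z))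
      has_sum upper_series L y z) UNIV"
      using upper_series_has_sum[of z] assms by simp
    show "((\<lambda>j. of_real (1 / cosh ((real_of_int (- int j - 1) + y) * L)) * exp (\<i> * of_real (real_of_int (- int j - 1) + y) * z))
      has_sum (lower_pole L y z - lower_rest L y z)) UNIV"
      using lower_series_has_sum[of z] assms unfolding e
      by (simp only: cosh_minus mult_minus_left mult_minus_right of_real_minus minus_minus)
  qed
  then have "((\<lambda>k. 1 / (2 * pi) * (of_real (1 / cosh ((real_of_int k + y) * L)) * exp (\<i> * of_real (real_of_int k + y) * z)))
     has_sum (1 / (2 * pi) * (upper_series L y z + (lower_pole L y z - lower_rest L y z)))) UNIV"
    by (rule has_sum_cmult_right)
  then show ?thesis
    by (simp add: fourier_side_def algebra_simps add_divide_distrib diff_divide_distrib)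
qed

lemma fourier_side_shift_period:
  fixes z :: complex
  shows "fourier_side L y (z + 2 * pi) = exp (2 * pi * \<i> * of_real y) * fourier_side L y z"
proof -
  have e: "exp (\<i> * (2 * pi) * of_nat j) = 1" for j
  proof -
    have "exp (\<i> * (2 * pi) * of_nat j) = exp (of_nat j * (2 * pi * \<i>))"
      by (simp add: mult_ac)
    moreover have "exp (of_real (2 * pi) * \<i>) = 1"
      by (metis exp_two_pi_i of_real_mult of_real_numeral)
    ultimately show ?thesis
      by (simp only: exp_of_nat_mult power_one)
  qed
  have "upper_series L y (z + 2 * pi) = exp (2 * pi * \<i> * of_real y) * upper_series L y z"
  proof -
    have "exp (\<i> * of_real (real j + y) * (z + 2 * pi)) =
      exp (2 * pi * \<i> * of_real y) * exp (\<i> * of_real (real j + y) * z)" for j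
    proof -
      have "\<i> * of_real (real j + y) * (z + 2 * pi) =
        2 * pi * \<i> * of_real y + \<i> * of_real (real j + y) * z + \<i> * (2 * pi) * of_nat j"
        by (simp add: algebra_simps)
      then show ?thesis by (simp only: exp_add e mult_1_right)
    qed
    then show ?thesis
      unfolding upper_series_def by (subst infsum_cmult_right'[symmetric], intro arg_cong[of _ _ "\<lambda>f. infsum f UNIV"] ext) (simp only: mult.left_commute)
  qed
  moreover have "lower_rest L y (z + 2 * pi) = exp (2 * pi * \<i> * of_real y) * lower_rest L y z"
  proof -
    have "exp (\<i> * of_real (real j + (1 - y)) * (- (z + 2 * pi))) =
      exp (2 * pi * \<i> * of_real y) * exp (\<i> * of_real (real j + (1 - y)) * (- z))" for j
    proof -
      have "\<i> * of_real (real j + (1 - y)) * (- (z + 2 * pi)) =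
        2 * pi * \<i> * of_real y + \<i> * of_real (real j + (1 - y)) * (- z) - \<i> * (2 * pi) * of_nat (Suc j)"
        by (simp add: algebra_simps)
      then show ?thesis by (simp only: exp_add exp_diff e div_by_1)
    qed
    then show ?thesis
      unfolding lower_rest_def by (subst infsum_cmult_right'[symmetric], intro arg_cong[of _ _ "\<lambda>f. infsum f UNIV"] ext) (simp only: mult.left_commute)
  qed
  moreover have "lower_pole L y (z + 2 * pi) = exp (2 * pi * \<i> * of_real y) * lower_pole L y z"
  proof -
    have 1: "- (of_real (1 - y) * (of_real L + \<i> * (z + 2 * pi))) =
       2 * pi * \<i> * of_real y + - (of_real (1 - y) * (of_real L + \<i> * z)) - \<i> * (2 * pi) * of_nat 1"
      by (simp add: algebra_simps)
    have 2: "- (of_real L + \<i> * (z + 2 * pi)) = - (of_real L + \<i> * z) - \<i> * (2 * pi) * of_nat 1"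
      by (simp add: algebra_simps)
    show ?thesis
      unfolding lower_pole_def 1 2 exp_add exp_diff e by simp
  qed
  ultimately show ?thesis
    by (simp add: fourier_side_def algebra_simps add_divide_distrib diff_divide_distrib)
qed

text \<open>
  In the sum of the values at \<open>z\<close> and \<open>z + 2 i L\<close> both one-sided series collapse to geometric
  series. The lower ones at \<open>z\<close> cancel against \<open>lower_rest\<close> at \<open>z + 2 i L\<close>, and \<open>lower_pole\<close> at
  \<open>z + 2 i L\<close> is minus the sum of the upper ones.
\<close>

lemma fourier_side_shift_imaginary:
  assumes "\<bar>Im z\<bar> < L"
  shows "fourier_side L y (z + 2 * \<i> * of_real L) = - fourier_side L y z"
proof -
  \<comment> \<open>With this \<open>w\<close>, \<open>exp (- w) = exp (i (z + i L))\<close> is the ratio of the upper geometric series.\<close>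
  let ?z = "z + 2 * \<i> * of_real L" and ?w = "of_real L - \<i> * z"
  have w: "Re ?w > 0"
    using assms by auto
  have sum: "upper_series L y z + upper_series L y ?z = 2 * exp (- (of_real y * ?w)) / (1 - exp (- ?w))"
  proof (rule has_sum_unique)
    let ?m = "\<lambda>j. real j + y"
    have "((\<lambda>j. of_real (1 / cosh (?m j * L)) * exp (\<i> * of_real (?m j) * z) +
        of_real (1 / cosh (?m j * L)) * exp (\<i> * of_real (?m j) * ?z))
      has_sum (upper_series L y z + upper_series L y ?z)) UNIV"
      using assms L by (intro has_sum_add upper_series_has_sum) auto
    moreover have "of_real (1 / cosh (?m j * L)) * exp (\<i> * of_real (?m j) * z) +
        of_real (1 / cosh (?m j * L)) * exp (\<i> * of_real (?m j) * ?z) =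
        2 * exp (- (of_real (?m j) * ?w))" for j
    proof -
      have 1: "\<i> * of_real (?m j) * ?z = of_real (- (2 * (?m j * L))) + \<i> * of_real (?m j) * z"
        by (simp add: algebra_simps)
      have 2: "- (of_real (?m j) * ?w) = of_real (- (?m j * L)) + \<i> * of_real (?m j) * z"
        by (simp add: algebra_simps)
      have "of_real (1 / cosh (?m j * L)) * exp (\<i> * of_real (?m j) * z) +
        of_real (1 / cosh (?m j * L)) * exp (\<i> * of_real (?m j) * ?z) =
        of_real (exp (- (2 * (?m j * L))) / cosh (?m j * L) + 1 / cosh (?m j * L)) * exp (\<i> * of_real (?m j) * z)"
        unfolding 1 exp_add exp_of_real by (simp add: algebra_simps)
      also have "\<dots> = 2 * exp (- (of_real (?m j) * ?w))"
        unfolding 2 exp_add exp_of_real exp_over_cosh_identity by simp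
      finally show ?thesis .
    qed
    ultimately show "((\<lambda>j. 2 * exp (- (of_real (?m j) * ?w))) has_sum (upper_series L y z + upper_series L y ?z)) UNIV"
      by simp
    show "((\<lambda>j. 2 * exp (- (of_real (?m j) * ?w))) has_sum (2 * exp (- (of_real y * ?w)) / (1 - exp (- ?w)))) UNIV"
      by (rule has_sum_geometric_exp[OF w])
  qed
  have rest: "lower_rest L y ?z = lower_pole L y z - lower_rest L y z"
  proof (rule has_sum_unique)
    let ?p = "\<lambda>j. real j + (1 - y)"
    have "of_real (exp (- (2 * (?p j * L))) / cosh (?p j * L)) * exp (\<i> * of_real (?p j) * (- ?z)) =
       of_real (1 / cosh (?p j * L)) * exp (\<i> * of_real (?p j) * (- z))" for j
    proof -
      have 1: "\<i> * of_real (?p j) * (- ?z) = of_real (2 * (?p j * L)) + \<i> * of_real (?p j) * (- z)"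
        by (simp add: algebra_simps)
      have comb: "of_real u * (of_real v * w) = of_real r * w" if "u * v = r" for u v r and w :: complex
        using that by (simp flip: of_real_mult mult.assoc)
      have 2: "exp (- (2 * x)) / cosh x * exp (2 * x) = 1 / cosh x" for x :: real
        by (simp add: exp_minus)
      show ?thesis
        unfolding 1 exp_add exp_of_real
        by (simp only: comb[OF 2])
    qed
    then show "((\<lambda>j. of_real (1 / cosh (?p j * L)) * exp (\<i> * of_real (?p j) * (- z))) has_sum lower_rest L y ?z) UNIV"
      using lower_rest_has_sum[of ?z] assms by simp
    show "((\<lambda>j. of_real (1 / cosh (?p j * L)) * exp (\<i> * of_real (?p j) * (- z))) has_sum
       (lower_pole L y z - lower_rest L y z)) UNIV"
      using assms by (intro lower_series_has_sum) auto
  qed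
  have pole: "lower_pole L y ?z = - (2 * exp (- (of_real y * ?w)) / (1 - exp (- ?w)))"
  proof -
    have "exp (- ?w) \<noteq> 1"
      using w by (metis norm_exp_eq_Re exp_less_one_iff neg_less_0_iff_less norm_one order_less_irrefl uminus_complex.sel(1))
    moreover have "exp ?w \<noteq> 1"
      using calculation by (metis exp_minus inverse_1)
    ultimately have ne: "1 - exp ?w \<noteq> 0" "1 - exp (- ?w) \<noteq> 0"
      by (metis right_minus_eq)+
    have 1: "- (of_real (1 - y) * (of_real L + \<i> * ?z)) = ?w + - (of_real y * ?w)"
      by (simp add: algebra_simps)
    have 2: "- (of_real L + \<i> * ?z) = ?w"
      by (simp add: algebra_simps)
    have 3: "exp ?w * (1 - exp (- ?w)) = - (1 - exp ?w)"
      by (simp add: algebra_simps exp_add[symmetric])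
    show ?thesis
      unfolding lower_pole_def 1 2 exp_add
      using ne 3 by (simp add: divide_simps del: minus_diff_eq) (simp add: algebra_simps)
  qed
  have "upper_series L y ?z + lower_pole L y ?z - lower_rest L y ?z =
     - (upper_series L y z + lower_pole L y z - lower_rest L y z)"
  proof -
    have "a' + p' - r' = - (a + p - r)" if "a + a' = s" "r' = p - r" "p' = - s" for a a' p p' r r' s :: complex
      using that by (auto simp: algebra_simps)
    then show ?thesis
      using sum rest pole by blast
  qed
  then show ?thesis
    unfolding fourier_side_def by (simp only: minus_divide_left)
qed

end

section \<open>Poisson summation for the hyperbolic secant\<close>

lemma abs_sinh_ge_exp:
  assumes "\<bar>u\<bar> \<ge> e" "(e::real) > 0"
  shows "\<bar>sinh u\<bar> \<ge> exp \<bar>u\<bar> * ((1 - exp (- (2 * e))) / 2)"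
proof -
  have 1: "\<bar>sinh u\<bar> = sinh \<bar>u\<bar>"
    by (cases "u \<ge> 0") (auto simp: abs_if)
  have 2: "sinh \<bar>u\<bar> = exp \<bar>u\<bar> * ((1 - exp (- (2 * \<bar>u\<bar>))) / 2)"
    by (simp add: sinh_def algebra_simps exp_add[symmetric])
  have "exp \<bar>u\<bar> * ((1 - exp (- (2 * e))) / 2) \<le> exp \<bar>u\<bar> * ((1 - exp (- (2 * \<bar>u\<bar>))) / 2)"
    using assms by (intro mult_left_mono divide_right_mono) auto
  then show ?thesis
    unfolding 1 2 .
qed

lemma holomorphic_on_cosh [holomorphic_intros]:
  "f holomorphic_on S \<Longrightarrow> (\<lambda>z. cosh (f z :: complex)) holomorphic_on S"
  unfolding cosh_conv_cos by (intro holomorphic_intros)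

text \<open>
  An open neighbourhood of the fundamental rectangle with sides \<open>2 \<pi>\<close> and \<open>2 L\<close> that contains
  only one pole, at \<open>i L\<close>.
\<close>

definition poisson_domain :: "real \<Rightarrow> complex set" where
  "poisson_domain L = {z. \<bar>Re z\<bar> < 2 * pi \<and> - L < Im z \<and> Im z < 3 * L}"

lemma poisson_domain: "open (poisson_domain L)" "connected (poisson_domain L)"
proof -
  have "poisson_domain L = box (Complex (- (2 * pi)) (- L)) (Complex (2 * pi) (3 * L))"
    by (auto simp: poisson_domain_def in_box_complex_iff)
  then show "open (poisson_domain L)" "connected (poisson_domain L)"
    using open_box convex_box convex_connected by metis+
qed

context
  fixes L y :: real
  assumes L: "L > 0" and y: "0 < y" "y \<le> 1"
begin

abbreviation (input) "rate \<equiv> pi / (2 * L)"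

text \<open>
  For \<open>|Re w| < 2 \<pi>\<close> the arguments \<open>w + 2 \<pi> k\<close> with \<open>k \<noteq> 0\<close> stay at a positive distance from
  the imaginary axis, where the poles lie, and the terms decay exponentially in \<open>|k|\<close>.
\<close>

lemma tail_term_bound:
  assumes "\<bar>Re w\<bar> \<le> 2 * pi - e" "e > 0" "k \<noteq> 0"
  shows "norm (exp (- (\<i> * of_real (2 * pi * y * of_int k))) * sech_density L (w + of_real (2 * pi * of_int k)))
     \<le> exp (2 * pi * rate) / (L * (1 - exp (- (2 * (rate * e))))) * exp (- (2 * pi * rate * \<bar>real_of_int k\<bar>))"
proof -
  define c where "c = (1 - exp (- (2 * (rate * e)))) / 2"
  define u where "u = rate * (Re w + 2 * pi * of_int k)"
  have rate: "rate > 0" using L by simp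
  have c: "c > 0" using L assms by (simp add: c_def)
  have k: "\<bar>real_of_int k\<bar> \<ge> 1"
    using assms(3) by linarith
  have "\<bar>Re w + 2 * pi * of_int k\<bar> \<ge> 2 * pi * \<bar>real_of_int k\<bar> - \<bar>Re w\<bar>"
    using abs_triangle_ineq2[of "2 * pi * of_int k" "- Re w"] by (simp add: abs_mult add.commute)
  then have 1: "\<bar>Re w + 2 * pi * of_int k\<bar> \<ge> 2 * pi * \<bar>real_of_int k\<bar> - 2 * pi + e"
    using assms by linarith
  have 2: "\<bar>u\<bar> = rate * \<bar>Re w + 2 * pi * of_int k\<bar>"
    unfolding u_def abs_mult abs_of_pos[OF rate] ..
  have "2 * pi * \<bar>real_of_int k\<bar> \<ge> 2 * pi"
    using k by simp
  then have "rate * e \<le> \<bar>u\<bar>"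
    unfolding 2 using rate 1 by (intro mult_left_mono) linarith+
  then have 3: "\<bar>sinh u\<bar> \<ge> exp \<bar>u\<bar> * c"
    unfolding c_def using L assms by (intro abs_sinh_ge_exp) auto
  have "rate * (2 * pi * \<bar>real_of_int k\<bar> - 2 * pi) \<le> \<bar>u\<bar>"
    unfolding 2 using rate 1 assms by (intro mult_left_mono) linarith+
  then have "exp (2 * pi * rate * \<bar>real_of_int k\<bar> - 2 * pi * rate) * c \<le> exp \<bar>u\<bar> * c"
    using c by (intro mult_right_mono) (auto simp: algebra_simps)
  also note 3
  also have "\<bar>sinh u\<bar> \<le> norm (cosh (of_real rate * (w + of_real (2 * pi * of_int k))))"
    using norm_cosh_ge[of "of_real rate * (w + of_real (2 * pi * of_int k))"] by (simp add: u_def)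
  finally have 4: "exp (2 * pi * rate * \<bar>real_of_int k\<bar> - 2 * pi * rate) * c
      \<le> norm (cosh (of_real rate * (w + of_real (2 * pi * of_int k))))" .
  have "norm (exp (- (\<i> * of_real (2 * pi * y * of_int k))) * sech_density L (w + of_real (2 * pi * of_int k)))
      = 1 / (2 * L * norm (cosh (of_real rate * (w + of_real (2 * pi * of_int k)))))"
    using L by (simp add: sech_density_def norm_mult norm_divide)
  also have "\<dots> \<le> 1 / (2 * L * (exp (2 * pi * rate * \<bar>real_of_int k\<bar> - 2 * pi * rate) * c))"
    using L c by (intro divide_left_mono mult_left_mono 4 mult_pos_pos order_less_le_trans[OF _ 4]) auto
  also have "\<dots> = exp (2 * pi * rate) / (L * (2 * c)) * exp (- (2 * pi * rate * \<bar>real_of_int k\<bar>))"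
    unfolding exp_diff exp_minus using L c by (simp add: field_simps)
  also have "2 * c = 1 - exp (- (2 * (rate * e)))"
    by (simp add: c_def)
  finally show ?thesis .
qed

lemma tail_bound_summable:
  "(\<lambda>k. C * exp (- (2 * pi * rate * \<bar>real_of_int k\<bar>))) summable_on A"
proof -
  have "(\<lambda>k. exp (- (2 * pi * rate * \<bar>real_of_int k\<bar>))) summable_on UNIV"
    using summable_on_exp_abs_int[of "2 * pi * rate" 0] L by simp
  then show ?thesis
    by (intro summable_on_cmult_right) (rule summable_on_subset_banach, auto)
qed

lemma tail_holomorphic:
  "(\<lambda>z. \<Sum>\<^sub>\<infinity>k\<in>UNIV - {0}. exp (- (\<i> * of_real (2 * pi * y * of_int k))) *
      sech_density L (z + of_real (2 * pi * of_int k))) holomorphic_on {z. \<bar>Re z\<bar> < 2 * pi}"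
proof (rule holomorphic_on_infsum)
  have "{z. \<bar>Re z\<bar> < 2 * pi} = {z. Re z < 2 * pi} \<inter> {z. Re z > - (2 * pi)}"
    by auto
  then show "open {z. \<bar>Re z\<bar> < 2 * pi}"
    by (simp add: open_Int open_halfspace_Re_gt open_halfspace_Re_lt)
next
  fix k :: int assume k: "k \<in> UNIV - {0}"
  have "cosh (of_real rate * (z + of_real (2 * pi * of_int k))) \<noteq> 0" if "\<bar>Re z\<bar> < 2 * pi" for z
  proof -
    have "\<bar>real_of_int k\<bar> \<ge> 1"
      using k by auto
    then have "\<bar>2 * pi * real_of_int k\<bar> \<ge> 2 * pi"
      by (simp add: abs_mult)
    then have "Re z + 2 * pi * of_int k \<noteq> 0"
      using that by linarith
    then have "\<bar>sinh (Re (of_real rate * (z + of_real (2 * pi * of_int k))))\<bar> > 0"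
      using L by simp
    then show ?thesis
      using norm_cosh_ge[of "of_real rate * (z + of_real (2 * pi * of_int k))"] by auto
  qed
  then show "(\<lambda>z. exp (- (\<i> * of_real (2 * pi * y * of_int k))) *
      sech_density L (z + of_real (2 * pi * of_int k))) holomorphic_on {z. \<bar>Re z\<bar> < 2 * pi}"
    unfolding sech_density_def using L by (intro holomorphic_intros) auto
next
  fix z assume "z \<in> {z. \<bar>Re z\<bar> < 2 * pi}"
  then have z: "\<bar>Re z\<bar> < 2 * pi" by simp
  define e where "e = (2 * pi - \<bar>Re z\<bar>) / 2"
  have e: "e > 0" using z by (simp add: e_def)
  let ?M = "\<lambda>k. exp (2 * pi * rate) / (L * (1 - exp (- (2 * (rate * e))))) * exp (- (2 * pi * rate * \<bar>real_of_int k\<bar>))"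
  have "norm (exp (- (\<i> * of_real (2 * pi * y * of_int k))) * sech_density L (w + of_real (2 * pi * of_int k))) \<le> ?M k"
    if "k \<noteq> 0" "w \<in> cball z e" for k w
  proof (rule tail_term_bound)
    have "\<bar>Re z - Re w\<bar> \<le> e"
      using that abs_Re_le_cmod[of "z - w"] by (simp add: dist_norm)
    moreover have "\<bar>Re z\<bar> = 2 * pi - 2 * e"
      by (simp add: e_def field_simps)
    ultimately show "\<bar>Re w\<bar> \<le> 2 * pi - e"
      by linarith
  qed (use e that in auto)
  then show "\<exists>r>0. \<exists>M. M summable_on UNIV - {0} \<and> (\<forall>k\<in>UNIV - {0}. \<forall>w\<in>cball z r \<inter> {z. \<bar>Re z\<bar> < 2 * pi}.
     norm (exp (- (\<i> * of_real (2 * pi * y * of_int k))) * sech_density L (w + of_real (2 * pi * of_int k))) \<le> M k)"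
    using e tail_bound_summable[of "exp (2 * pi * rate) / (L * (1 - exp (- (2 * (rate * e)))))" "UNIV - {0}"]
    by (intro exI[of _ e] conjI exI[of _ ?M]) auto
qed

lemma twisted_sum_split:
  assumes "\<bar>Re z\<bar> < 2 * pi"
  shows "twisted_sum L y z = sech_density L z + (\<Sum>\<^sub>\<infinity>k\<in>UNIV - {0}. exp (- (\<i> * of_real (2 * pi * y * of_int k))) *
      sech_density L (z + of_real (2 * pi * of_int k)))"
proof -
  let ?f = "\<lambda>k. exp (- (\<i> * of_real (2 * pi * y * of_int k))) * sech_density L (z + of_real (2 * pi * of_int k))"
  let ?e = "2 * pi - \<bar>Re z\<bar>"
  have "(\<lambda>k. norm (?f k)) summable_on (UNIV - {0})"
  proof (rule summable_on_comparison_test[OF tail_bound_summable])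
    show "norm (?f k) \<le> exp (2 * pi * rate) / (L * (1 - exp (- (2 * (rate * ?e))))) * exp (- (2 * pi * rate * \<bar>real_of_int k\<bar>))"
      if "k \<in> UNIV - {0}" for k
      using that assms by (intro tail_term_bound) auto
  qed auto
  then have "?f summable_on (UNIV - {0})"
    by (rule abs_summable_summable)
  then have "infsum ?f (insert 0 (UNIV - {0})) = ?f 0 + infsum ?f (UNIV - {0})"
    by (rule infsum_insert) simp
  then show ?thesis
    by (simp add: twisted_sum_def insert_UNIV)
qed

abbreviation (input) "gap z \<equiv> twisted_sum L y z - fourier_side L y z"

lemma cosh_zero_iff_pole:
  assumes "z \<in> poisson_domain L"
  shows "cosh (of_real rate * z) = 0 \<longleftrightarrow> z = \<i> * of_real L"
proof
  assume 0: "cosh (of_real rate * z) = 0"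
  have *: "rate * (- L) < rate * Im z" "rate * Im z < rate * (3 * L)"
    by (rule mult_strict_left_mono; use assms L in \<open>simp add: poisson_domain_def\<close>)+
  have eq: "rate * (- L) = - pi / 2" "rate * (3 * L) = 3 * pi / 2" "rate * Im z = Im (of_real rate * z)"
    using L by simp_all
  have "- pi / 2 < Im (of_real rate * z)" "Im (of_real rate * z) < 3 * pi / 2"
    using *[unfolded eq] .
  with 0 have "of_real rate * z = \<i> * of_real (pi / 2)"
    by (intro cosh_eq_0_in_strip) auto
  then show "z = \<i> * of_real L"
    using L by (simp add: field_simps)
next
  assume z: "z = \<i> * of_real L"
  have "of_real rate * z = \<i> * of_real (pi / 2)"
    using L by (simp add: z field_simps)
  moreover have "\<i> * (\<i> * of_real (pi / 2)) = complex_of_real (- (pi / 2))"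
    by simp
  ultimately show "cosh (of_real rate * z) = 0"
    by (simp only: cosh_conv_cos cos_of_real cos_minus cos_pi_half of_real_0)
qed

lemma pole_denominator_zero_iff:
  assumes "z \<in> poisson_domain L"
  shows "exp (- (of_real L + \<i> * z)) = 1 \<longleftrightarrow> z = \<i> * of_real L"
proof
  assume "exp (- (of_real L + \<i> * z)) = 1"
  then obtain n :: int where n: "Re (- (of_real L + \<i> * z)) = 0" "Im (- (of_real L + \<i> * z)) = of_int (2 * n) * pi"
    unfolding exp_eq_1 by blast
  have "\<bar>real_of_int n * pi\<bar> < 1 * pi"
    using n(2) assms by (auto simp: poisson_domain_def)
  then have "\<bar>real_of_int n\<bar> < 1"
    unfolding abs_mult by simp
  then have "n = 0" by linarith
  with n show "z = \<i> * of_real L"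
    by (simp add: complex_eq_iff)
qed (simp add: algebra_simps)

text \<open>
  Both functions have residue \<open>1 / (\<pi> i)\<close> at \<open>i L\<close>.
\<close>

lemma residues_agree:
  "((\<lambda>z. (z - \<i> * of_real L) * (sech_density L z - lower_pole L y z / (2 * pi))) \<longlongrightarrow> 0) (at (\<i> * of_real L))"
proof -
  let ?p = "\<i> * of_real L"
  have p: "?p \<in> poisson_domain L"
    using L by (simp add: poisson_domain_def)
  have ap: "of_real rate * ?p = \<i> * of_real (pi / 2)"
    using L by (simp add: field_simps)
  have "((\<lambda>z. 2 * of_real L * cosh (of_real rate * z)) has_field_derivative 2 * of_real L * (sinh (of_real rate * ?p) * of_real rate)) (at ?p)"
    by (auto intro!: derivative_eq_intros)
  moreover have "2 * of_real L * (sinh (of_real rate * ?p) * of_real rate) = \<i> * pi"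
  proof -
    have "sinh (\<i> * of_real (pi / 2)) = \<i>"
      by (simp add: sinh_conv_sin)
    then show ?thesis
      unfolding ap using L by simp
  qed
  ultimately have "((\<lambda>z. 2 * of_real L * cosh (of_real rate * z)) has_field_derivative \<i> * pi) (at ?p)"
    by simp
  then have 1: "((\<lambda>z. (z - ?p) / (2 * of_real L * cosh (of_real rate * z))) \<longlongrightarrow> 1 / (\<i> * pi)) (at ?p)"
    using cosh_zero_iff_pole[OF p] by (intro tendsto_div_simple_zero) auto
  have "((\<lambda>z. 1 - exp (- (of_real L + \<i> * z))) has_field_derivative exp (- (of_real L + \<i> * ?p)) * \<i>) (at ?p)"
    by (auto intro!: derivative_eq_intros)
  then have "((\<lambda>z. 1 - exp (- (of_real L + \<i> * z))) has_field_derivative \<i>) (at ?p)"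
    using pole_denominator_zero_iff[OF p] by simp
  then have "((\<lambda>z. (z - ?p) / (1 - exp (- (of_real L + \<i> * z)))) \<longlongrightarrow> 1 / \<i>) (at ?p)"
    using pole_denominator_zero_iff[OF p] by (intro tendsto_div_simple_zero) auto
  moreover have "((\<lambda>z. 2 * exp (- (of_real (1 - y) * (of_real L + \<i> * z))) / (2 * pi)) \<longlongrightarrow>
      2 * exp (- (of_real (1 - y) * (of_real L + \<i> * ?p))) / (2 * pi)) (at ?p)"
    by (intro tendsto_intros) auto
  ultimately have 2: "((\<lambda>z. 2 * exp (- (of_real (1 - y) * (of_real L + \<i> * z))) / (2 * pi) *
     ((z - ?p) / (1 - exp (- (of_real L + \<i> * z))))) \<longlongrightarrow>
     2 * exp (- (of_real (1 - y) * (of_real L + \<i> * ?p))) / (2 * pi) * (1 / \<i>)) (at ?p)"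
    by (intro tendsto_mult)
  have "2 * exp (- (of_real (1 - y) * (of_real L + \<i> * ?p))) / (2 * pi) * (1 / \<i>) = 1 / (\<i> * pi)"
    by (simp add: field_simps)
  note lim = tendsto_diff[OF 1 2[unfolded this], unfolded diff_self]
  have "u * (1 / x - v / w / q) = u / x - v / q * (u / w)" for u v w x q :: complex
    by (simp add: algebra_simps)
  then show ?thesis
    unfolding sech_density_def lower_pole_def using lim by simp
qed

text \<open>
  The pole of the term \<open>k = 0\<close> cancels against \<open>lower_pole\<close> by \<open>residues_agree\<close>; everything
  else is holomorphic on the domain.
\<close>

lemma difference_extends:
  obtains E where "E holomorphic_on poisson_domain L" "\<And>z. z \<in> poisson_domain L - {\<i> * of_real L} \<Longrightarrow> E z = gap z"
proof -
  let ?p = "\<i> * of_real L"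
  define f where "f = (\<lambda>z. sech_density L z - lower_pole L y z / (2 * pi))"
  have p: "?p \<in> poisson_domain L"
    using L by (simp add: poisson_domain_def)
  have "f holomorphic_on poisson_domain L - {?p}"
    unfolding f_def sech_density_def lower_pole_def
    using cosh_zero_iff_pole pole_denominator_zero_iff L by (intro holomorphic_intros) auto
  then obtain g where g: "g holomorphic_on poisson_domain L" "\<And>z. z \<in> poisson_domain L - {?p} \<Longrightarrow> g z = f z"
    using holomorphic_on_extend_lim[of f "poisson_domain L" ?p] residues_agree p poisson_domain(1)
    by (auto simp: f_def interior_open)
  define R where "R = (\<lambda>z. (\<Sum>\<^sub>\<infinity>k\<in>UNIV - {0}. exp (- (\<i> * of_real (2 * pi * y * of_int k))) *
      sech_density L (z + of_real (2 * pi * of_int k))) - (upper_series L y z - lower_rest L y z) / (2 * pi))"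
  have up: "upper_series L y holomorphic_on poisson_domain L"
  proof -
    have "upper_series L y holomorphic_on {z. Im z > - L}"
      unfolding upper_series_def
      by (rule holomorphic_on_exp_series) (use y upper_coeff_bound in auto)
    then show ?thesis
      by (rule holomorphic_on_subset) (auto simp: poisson_domain_def)
  qed
  have low: "lower_rest L y holomorphic_on poisson_domain L"
  proof -
    define q where "q = (\<lambda>z. \<Sum>\<^sub>\<infinity>j. of_real (exp (- (2 * ((real j + (1 - y)) * L))) / cosh ((real j + (1 - y)) * L)) *
            exp (\<i> * of_real (real j + (1 - y)) * z))"
    have "q holomorphic_on {z. Im z > - (3 * L)}"
      unfolding q_def
    proof (rule holomorphic_on_exp_series)
      show "norm (complex_of_real (exp (- (2 * ((real j + (1 - y)) * L))) / cosh ((real j + (1 - y)) * L)))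
        \<le> 2 * exp (- ((real j + (1 - y)) * (3 * L)))" for j
        by (rule lower_coeff_bound)
    qed (use y in auto)
    moreover have "(\<lambda>z. - z) holomorphic_on poisson_domain L"
      by (intro holomorphic_intros)
    moreover have "(\<lambda>z. - z) ` poisson_domain L \<subseteq> {z. Im z > - (3 * L)}"
      by (auto simp: poisson_domain_def)
    ultimately have "q \<circ> (\<lambda>z. - z) holomorphic_on poisson_domain L"
      by (intro holomorphic_on_compose_gen)
    moreover have "q \<circ> (\<lambda>z. - z) = lower_rest L y"
      by (simp add: fun_eq_iff q_def lower_rest_def)
    ultimately show ?thesis
      by simp
  qed
  have tail: "(\<lambda>z. \<Sum>\<^sub>\<infinity>k\<in>UNIV - {0}. exp (- (\<i> * of_real (2 * pi * y * of_int k))) *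
      sech_density L (z + of_real (2 * pi * of_int k))) holomorphic_on poisson_domain L"
    by (rule holomorphic_on_subset[OF tail_holomorphic]) (auto simp: poisson_domain_def)
  have "R holomorphic_on poisson_domain L"
    unfolding R_def by (intro holomorphic_intros tail up low) auto
  show ?thesis
  proof
    show "(\<lambda>z. g z + R z) holomorphic_on poisson_domain L"
      by (intro holomorphic_intros g \<open>R holomorphic_on poisson_domain L\<close>)
    show "g z + R z = gap z" if "z \<in> poisson_domain L - {?p}" for z
    proof -
      have "\<bar>Re z\<bar> < 2 * pi"
        using that by (simp add: poisson_domain_def)
      then show ?thesis
        using g(2)[OF that]
        by (simp add: f_def R_def twisted_sum_split fourier_side_def add_divide_distrib diff_divide_distrib)
    qed
  qed
qed

lemma norm_difference_shift_period:
  fixes z :: complex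
  shows "norm (gap (z + 2 * pi)) = norm (gap z)"
proof -
  have "gap (z + 2 * pi) = exp (2 * pi * \<i> * of_real y) * gap z"
    using twisted_sum_shift_period[of L y z 1] fourier_side_shift_period[OF L y, of z]
    by (simp add: algebra_simps)
  then show ?thesis
    by (simp add: norm_mult)
qed

text \<open>
  The modulus of the extended difference is bounded by its maximum over the closed fundamental
  rectangle: any other point of the domain is moved into the rectangle by the two shifts. The
  maximum is attained at an interior point of the domain, so the difference is constant, and
  being negated by the shift \<open>2 i L\<close> it is 0.
\<close>

lemma difference_vanishes:
  assumes "z \<in> poisson_domain L" "z \<noteq> \<i> * of_real L"
  shows "twisted_sum L y z = fourier_side L y z"
proof -
  let ?p = "\<i> * of_real L"
  obtain E where E: "E holomorphic_on poisson_domain L"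
    "\<And>z. z \<in> poisson_domain L - {?p} \<Longrightarrow> E z = gap z"
    using difference_extends by blast
  let ?K = "cbox (Complex (- pi) 0) (Complex pi (2 * L))"
  have K: "?K \<subseteq> poisson_domain L" "0 \<in> ?K"
    using L pi_gt_zero by (auto simp: poisson_domain_def in_cbox_complex_iff abs_less_iff simp del: pi_gt_zero)
  have "continuous_on ?K (\<lambda>z. norm (E z))"
    by (intro continuous_on_norm holomorphic_on_imp_continuous_on holomorphic_on_subset[OF E(1) K(1)])
  then obtain m where m: "m \<in> ?K" "\<And>w. w \<in> ?K \<Longrightarrow> norm (E w) \<le> norm (E m)"
    using continuous_attains_sup[of ?K "\<lambda>z. norm (E z)"] K by auto
  \<comment> \<open>The pole has real part 0, so no two points of the domain that differ by \<open>2 \<pi>\<close> meet it.\<close>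
  have per: "norm (E w) = norm (E (w + 2 * pi))"
    if "w \<in> poisson_domain L" "w + 2 * pi \<in> poisson_domain L" for w
  proof -
    have "w \<noteq> ?p" "w + 2 * pi \<noteq> ?p"
      using that by (auto simp: poisson_domain_def complex_eq_iff)
    then show ?thesis
      using that norm_difference_shift_period by (simp add: E(2))
  qed
  have imag: "E (w + 2 * \<i> * of_real L) = - E w" if "w \<in> poisson_domain L" "Im w < L" for w
  proof -
    have *: "\<bar>Im w\<bar> < L" "w \<noteq> ?p" "w + 2 * \<i> * of_real L \<noteq> ?p" "w + 2 * \<i> * of_real L \<in> poisson_domain L"
      using that by (auto simp: poisson_domain_def complex_eq_iff)
    then show ?thesis
      using that twisted_sum_shift_imaginary[OF L, of y w] fourier_side_shift_imaginary[OF L y *(1)]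
      by (simp add: E(2))
  qed
  \<comment> \<open>The vertical shift moves points just below the rectangle up and points just above it down.\<close>
  have strip: "norm (E w) \<le> norm (E m)" if w: "w \<in> poisson_domain L" "\<bar>Re w\<bar> \<le> pi" for w
  proof -
    consider "w \<in> ?K" | "Im w < 0" | "Im w > 2 * L"
      using w by (force simp: in_cbox_complex_iff)
    then show ?thesis
    proof cases
      case 2
      then have "norm (E w) = norm (E (w + 2 * \<i> * of_real L))"
        using imag[OF w(1)] L by simp
      also have "\<dots> \<le> norm (E m)"
        using 2 w by (intro m) (auto simp: in_cbox_complex_iff poisson_domain_def)
      finally show ?thesis .
    next
      case 3
      let ?v = "w - 2 * \<i> * of_real L"
      have "norm (E w) = norm (E ?v)"
        using imag[of ?v] w 3 by (simp add: poisson_domain_def)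
      also have "\<dots> \<le> norm (E m)"
        using 3 w L by (intro m) (auto simp: in_cbox_complex_iff poisson_domain_def)
      finally show ?thesis .
    qed (rule m)
  qed
  have max: "norm (E w) \<le> norm (E m)" if w: "w \<in> poisson_domain L" for w
  proof -
    consider "\<bar>Re w\<bar> \<le> pi" | "Re w < - pi" | "Re w > pi"
      by linarith
    then show ?thesis
    proof cases
      case 2
      then have *: "w + 2 * pi \<in> poisson_domain L" "\<bar>Re (w + 2 * pi)\<bar> \<le> pi"
        using w by (auto simp: poisson_domain_def)
      show ?thesis
        using per[OF w *(1)] strip[OF *] by simp
    next
      case 3
      then have *: "w - 2 * pi \<in> poisson_domain L" "\<bar>Re (w - 2 * pi)\<bar> \<le> pi"
        using w by (auto simp: poisson_domain_def)
      show ?thesis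
        using per[OF *(1)] strip[OF *] w by simp
    qed (use strip w in blast)
  qed
  have "E constant_on poisson_domain L"
    using m(1) K(1) max by (intro maximum_modulus_principle[OF E(1) poisson_domain, of "poisson_domain L" m] poisson_domain) auto
  then obtain c where c: "\<And>w. w \<in> poisson_domain L \<Longrightarrow> E w = c"
    unfolding constant_on_def by blast
  have "0 \<in> poisson_domain L" "0 + 2 * \<i> * of_real L \<in> poisson_domain L"
    using L by (auto simp: poisson_domain_def)
  then have "c = 0"
    using imag[of 0] c L by simp
  then show ?thesis
    using c E(2)[of z] assms by simp
qed

end

text \<open>
  The identity holds on one period by \<open>difference_vanishes\<close>; both sides scale alike under
  shifts by \<open>2 \<pi>\<close>, which gives all real \<open>t\<close>.
\<close>

theorem poisson_summation_sech:
  fixes t :: real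
  assumes "L > 0" "0 < y" "y \<le> 1"
  shows "((\<lambda>k. 1 / (2 * pi) * (of_real (1 / cosh ((real_of_int k + y) * L)) *
            exp (\<i> * of_real (real_of_int k + y) * t)))
          has_sum twisted_sum L y t) UNIV"
proof -
  define k where "k = \<lfloor>t / (2 * pi)\<rfloor>"
  define u where "u = t - 2 * pi * of_int k"
  have "of_int k \<le> t / (2 * pi)" "t / (2 * pi) < of_int k + 1"
    unfolding k_def by linarith+
  then have u: "0 \<le> u" "u < 2 * pi"
    unfolding u_def by (simp_all add: field_simps)
  have t: "complex_of_real t = of_real u + of_real (2 * pi * of_int k)"
    by (simp add: u_def)
  have "complex_of_real u \<in> poisson_domain L"
    using u assms by (simp add: poisson_domain_def)
  moreover have "complex_of_real u \<noteq> \<i> * of_real L"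
    using assms by (simp add: complex_eq_iff)
  ultimately have eq: "twisted_sum L y u = fourier_side L y u"
    by (rule difference_vanishes[OF assms])
  have "((\<lambda>l. 1 / (2 * pi) * (of_real (1 / cosh ((real_of_int l + y) * L)) *
            exp (\<i> * of_real (real_of_int l + y) * u))) has_sum twisted_sum L y u) UNIV"
    unfolding eq using assms by (intro fourier_side_has_sum) auto
  then have "((\<lambda>l. exp (\<i> * of_real (2 * pi * y * of_int k)) * (1 / (2 * pi) * (of_real (1 / cosh ((real_of_int l + y) * L)) *
            exp (\<i> * of_real (real_of_int l + y) * u)))) has_sum twisted_sum L y t) UNIV"
    unfolding t twisted_sum_shift_period by (rule has_sum_cmult_right)
  moreover have "exp (\<i> * of_real (2 * pi * y * of_int k)) * exp (\<i> * of_real (real_of_int l + y) * u)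
      = exp (\<i> * of_real (real_of_int l + y) * t)" for l
  proof -
    have "\<i> * of_real (real_of_int l + y) * t = \<i> * of_real (2 * pi * y * of_int k) +
        \<i> * of_real (real_of_int l + y) * u + 2 * of_int (l * k) * pi * \<i>"
      unfolding t by (simp add: algebra_simps)
    moreover have "exp (2 * of_int (l * k) * pi * \<i>) = 1"
      using exp_integer_2pi[of "of_int (l * k)"] by (simp add: mult_ac)
    ultimately show ?thesis
      by (simp only: exp_add mult_1_right)
  qed
  ultimately show ?thesis
    by (simp only: mult.left_commute)
qed

section \<open>Row expansions and Vandermonde determinants\<close>

text \<open>
  Induction on the number of factors, by Fubini for absolutely convergent sums.
\<close>

lemma abs_summable_on_prod_PiE:
  fixes f :: "'i \<Rightarrow> 'k \<Rightarrow> complex"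
  assumes "finite A" "\<And>x. x \<in> A \<Longrightarrow> (\<lambda>k. norm (f x k)) summable_on B x"
  shows "(\<lambda>g. norm (\<Prod>x\<in>A. f x (g x))) summable_on PiE A B"
  using assms
proof (induction A rule: finite_induct)
  case (insert x A)
  let ?P = "\<lambda>g. \<Prod>x\<in>A. f x (g x)"
  have P: "(\<lambda>g. norm (?P g)) summable_on PiE A B"
    using insert by simp
  have upd: "(\<Prod>z\<in>insert x A. f z ((g(x := y)) z)) = f x y * ?P g" for y g
  proof -
    have "(\<Prod>z\<in>A. f z ((g(x := y)) z)) = ?P g"
      by (rule prod.cong) (use insert.hyps in auto)
    then show ?thesis
      using insert.hyps by simp
  qed
  have "(\<lambda>p. norm (f x (fst p) * ?P (snd p))) summable_on B x \<times> PiE A B"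
  proof (subst Infinite_Sum.abs_summable_on_Sigma_iff, intro conjI ballI)
    show "(\<lambda>g. norm (f x (fst (y, g)) * ?P (snd (y, g)))) summable_on PiE A B" for y
      using summable_on_cmult_right[OF P, of "norm (f x y)"] by (simp add: norm_mult)
    have "(\<lambda>y. norm (f x y) * infsum (\<lambda>g. norm (?P g)) (PiE A B)) summable_on B x"
      using insert.prems by (intro summable_on_cmult_left) auto
    then show "(\<lambda>y. norm (\<Sum>\<^sub>\<infinity>g\<in>PiE A B. norm (f x (fst (y, g)) * ?P (snd (y, g))))) summable_on B x"
      by (simp add: norm_mult infsum_cmult_right' abs_mult infsum_nonneg prod_nonneg)
  qed
  then have "(\<lambda>g. norm (\<Prod>z\<in>insert x A. f z (g z))) summable_on (\<lambda>(y, g). g(x := y)) ` (B x \<times> PiE A B)"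
    by (subst summable_on_reindex[OF inj_combinator[OF insert.hyps(2)]])
       (simp only: o_def case_prod_unfold upd)
  then show ?case
    by (simp only: PiE_insert_eq)
qed simp

lemma has_sum_prod_PiE:
  fixes f :: "'i \<Rightarrow> 'k \<Rightarrow> complex"
  assumes "finite A" "\<And>x. x \<in> A \<Longrightarrow> (\<lambda>k. norm (f x k)) summable_on B x"
  shows "((\<lambda>g. \<Prod>x\<in>A. f x (g x)) has_sum (\<Prod>x\<in>A. infsum (f x) (B x))) (PiE A B)"
  using abs_summable_summable[OF abs_summable_on_prod_PiE[OF assms]] infsum_prod_PiE_abs[OF assms]
  by (simp add: has_sum_iff)

lemma det_mat:
  "Determinant.det (Matrix.mat n n f) = (\<Sum>p | p permutes {0..<n}. signof p * (\<Prod>i = 0..<n. f (i, p i)))"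
proof -
  have "(\<Prod>i = 0..<n. Matrix.mat n n f $$ (i, p i)) = (\<Prod>i = 0..<n. f (i, p i))" if "p permutes {0..<n}" for p
    using that permutes_in_image[OF that] by (intro prod.cong) auto
  then show ?thesis
    by (subst det_def'[of _ n]) auto
qed

lemma det_mat_cong:
  assumes "\<And>i j. i < n \<Longrightarrow> j < n \<Longrightarrow> f (i, j) = g (i, j)"
  shows "Determinant.det (Matrix.mat n n f) = Determinant.det (Matrix.mat n n g)"
  using assms by (intro arg_cong[of _ _ Determinant.det] eq_matI) auto

lemma has_sum_sum:
  fixes f :: "'i \<Rightarrow> 'k \<Rightarrow> 'a :: topological_comm_monoid_add"
  assumes "\<And>i. i \<in> I \<Longrightarrow> (f i has_sum s i) A"
  shows "((\<lambda>x. \<Sum>i\<in>I. f i x) has_sum (\<Sum>i\<in>I. s i)) A"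
  using assms
  by (induction I rule: infinite_finite_induct) (auto intro: has_sum_add)

text \<open>
  An infinite Cauchy-Binet expansion: multilinearity in the rows, with \<open>g i\<close> the summation
  index chosen in row \<open>i\<close>.
\<close>

lemma det_row_expansion:
  fixes u :: "nat \<Rightarrow> 'k \<Rightarrow> complex" and v :: "'k \<Rightarrow> nat \<Rightarrow> complex"
  assumes "\<And>i j. i < n \<Longrightarrow> j < n \<Longrightarrow> (\<lambda>k. norm (u i k * v k j)) summable_on K"
  shows "((\<lambda>g. (\<Prod>i = 0..<n. u i (g i)) * Determinant.det (Matrix.mat n n (\<lambda>(i, j). v (g i) j)))
     has_sum Determinant.det (Matrix.mat n n (\<lambda>(i, j). \<Sum>\<^sub>\<infinity>k\<in>K. u i k * v k j))) (PiE {0..<n} (\<lambda>_. K))"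
proof -
  have "((\<lambda>g. \<Sum>p | p permutes {0..<n}. signof p * (\<Prod>i = 0..<n. u i (g i) * v (g i) (p i))) has_sum
     (\<Sum>p | p permutes {0..<n}. signof p * (\<Prod>i = 0..<n. \<Sum>\<^sub>\<infinity>k\<in>K. u i k * v k (p i)))) (PiE {0..<n} (\<lambda>_. K))"
  proof (intro has_sum_sum has_sum_cmult_right has_sum_prod_PiE)
    fix p i assume "p \<in> {p. p permutes {0..<n}}" "i \<in> {0..<n}"
    then show "(\<lambda>k. norm (u i k * v k (p i))) summable_on K"
      using permutes_in_image[of p "{0..<n}" i] by (intro assms) auto
  qed auto
  then show ?thesis
    by (simp add: det_mat prod.distrib sum_distrib_left mult_ac)
qed

lemma norm_det_mat_le:
  fixes f :: "nat \<times> nat \<Rightarrow> complex"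
  assumes "\<And>i j. i < n \<Longrightarrow> j < n \<Longrightarrow> norm (f (i, j)) \<le> 1"
  shows "norm (Determinant.det (Matrix.mat n n f)) \<le> fact n"
proof -
  have "norm (Determinant.det (Matrix.mat n n f)) \<le> (\<Sum>p | p permutes {0..<n}. 1)"
    unfolding det_mat
  proof (rule sum_norm_le)
    fix p assume "p \<in> {p. p permutes {0..<n}}"
    then have "(\<Prod>i = 0..<n. norm (f (i, p i))) \<le> 1"
      using permutes_in_image[of p "{0..<n}"] assms by (intro prod_le_1) auto
    then show "norm (signof p * (\<Prod>i = 0..<n. f (i, p i))) \<le> 1"
      by (simp add: norm_mult prod_norm sign_def)
  qed
  then show ?thesis
    by (simp add: card_permutations[OF refl])
qed

lemma det_scale_columns:
  fixes c :: "nat \<Rightarrow> complex"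
  shows "Determinant.det (Matrix.mat n n (\<lambda>(i, j). c j * f i j)) =
    (\<Prod>j = 0..<n. c j) * Determinant.det (Matrix.mat n n (\<lambda>(i, j). f i j))"
proof -
  have "(\<Prod>i = 0..<n. c (p i)) = (\<Prod>j = 0..<n. c j)" if "p permutes {0..<n}" for p
    using prod.permute[OF that, of c] by (simp add: o_def)
  then show ?thesis
    by (simp add: det_mat prod.distrib sum_distrib_left mult_ac)
qed

lemma det_swap_indices:
  "Determinant.det (Matrix.mat n n (\<lambda>(i, j). f j i)) = Determinant.det (Matrix.mat n n (\<lambda>(i, j). f i j))"
proof -
  have "Matrix.mat n n (\<lambda>(i, j). f j i) = transpose_mat (Matrix.mat n n (\<lambda>(i, j). f i j))"
    by (rule eq_matI) auto
  then show ?thesis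
    using det_transpose[of "Matrix.mat n n (\<lambda>(i, j). f i j)" n] by simp
qed

lemma det_cnj:
  "Determinant.det (Matrix.mat n n (\<lambda>(i, j). cnj (f i j))) = cnj (Determinant.det (Matrix.mat n n (\<lambda>(i, j). f i j)))"
  unfolding det_mat by (auto simp: sign_def intro!: sum.cong)

text \<open>
  Multiply on the left by the unitriangular matrix of coefficients of the monic polynomials
  \<open>\<Prod>\<^sub>i\<^sub><\<^sub>k (X - x\<^sub>i)\<close>. The product has the entries \<open>\<Prod>\<^sub>i\<^sub><\<^sub>k (x\<^sub>j - x\<^sub>i)\<close>, hence is
  triangular.
\<close>

lemma det_vandermonde:
  fixes x :: "nat \<Rightarrow> 'a :: idom"
  shows "Determinant.det (Matrix.mat n n (\<lambda>(k, j). x j ^ k)) = (\<Prod>j<n. \<Prod>i<j. x j - x i)"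
proof -
  define q where "q k = (\<Prod>i<k. [:- x i, 1:])" for k
  have monic: "lead_coeff (q k) = 1" and deg: "degree (q k) = k" for k
    unfolding q_def lead_coeff_prod by (simp_all add: degree_prod_eq_sum_degree)
  have q: "poly (q k) (x j) = (\<Prod>i<k. x j - x i)" for k j
    by (simp add: q_def poly_prod)
  let ?V = "Matrix.mat n n (\<lambda>(k, j). x j ^ k)"
  let ?B = "Matrix.mat n n (\<lambda>(k, l). coeff (q k) l)"
  let ?U = "Matrix.mat n n (\<lambda>(k, j). poly (q k) (x j))"
  have "?B * ?V = ?U"
  proof (rule eq_matI)
    fix k j assume "k < dim_row ?U" "j < dim_col ?U"
    then have kj: "k < n" "j < n" by auto
    then have "(?B * ?V) $$ (k, j) = (\<Sum>l = 0..<n. coeff (q k) l * x j ^ l)"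
      by (simp add: scalar_prod_def)
    also have "\<dots> = (\<Sum>l\<le>k. coeff (q k) l * x j ^ l)"
      using kj deg by (intro sum.mono_neutral_right) (auto simp: coeff_eq_0)
    also have "\<dots> = ?U $$ (k, j)"
      using kj by (simp add: poly_altdef deg)
    finally show "(?B * ?V) $$ (k, j) = ?U $$ (k, j)" .
  qed auto
  moreover have "Determinant.det ?B = 1"
  proof -
    have "Determinant.det ?B = prod_list (diag_mat ?B)"
      by (rule det_lower_triangular[of n]) (auto simp: coeff_eq_0 deg)
    also have "diag_mat ?B = map (\<lambda>_. 1) [0..<n]"
      unfolding diag_mat_def using monic deg by (auto intro!: map_cong)
    finally show ?thesis
      by (simp add: map_replicate_const)
  qed
  moreover have "Determinant.det ?U = (\<Prod>j<n. \<Prod>i<j. x j - x i)"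
  proof -
    have "Determinant.det ?U = prod_list (diag_mat ?U)"
      by (rule det_upper_triangular[of _ n]) (auto simp: upper_triangular_def q)
    also have "diag_mat ?U = map (\<lambda>j. \<Prod>i<j. x j - x i) [0..<n]"
      unfolding diag_mat_def by (auto simp: q intro!: map_cong)
    also have "prod_list \<dots> = (\<Prod>j<n. \<Prod>i<j. x j - x i)"
      by (simp add: prod.distinct_set_conv_list[symmetric] lessThan_atLeast0)
    finally show ?thesis .
  qed
  ultimately show ?thesis
    using det_mult[of ?B n ?V] by simp
qed

lemma cis_diff: "cis b - cis a = - \<i> * cis ((a + b) / 2) * of_real (2 * sin ((a - b) / 2))"
proof -
  have 1: "b = (a + b) / 2 + - ((a - b) / 2)" and 2: "a = (a + b) / 2 + (a - b) / 2"
    by (simp_all add: field_simps)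
  have "cis b - cis a = cis ((a + b) / 2) * (cis (- ((a - b) / 2)) - cis ((a - b) / 2))"
    unfolding right_diff_distrib cis_mult 1[symmetric] 2[symmetric] ..
  also have "cis (- ((a - b) / 2)) - cis ((a - b) / 2) = - \<i> * of_real (2 * sin ((a - b) / 2))"
    by (simp add: complex_eq_iff)
  finally show ?thesis
    by (simp add: mult_ac)
qed

lemma cis_diff_eq_norm:
  assumes "0 \<le> a - b" "a - b \<le> 2 * pi"
  shows "cis b - cis a = - \<i> * cis ((a + b) / 2) * of_real (cmod (cis a - cis b))"
proof -
  have "sin ((a - b) / 2) \<ge> 0"
    using assms by (intro sin_ge_zero) auto
  moreover have "cmod (cis a - cis b) = cmod (cis b - cis a)"
    by (rule norm_minus_commute)
  ultimately have "cmod (cis a - cis b) = 2 * sin ((a - b) / 2)"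
    by (simp only: cis_diff norm_mult norm_minus_cancel norm_ii norm_cis) simp
  then show ?thesis
    by (simp only: cis_diff)
qed

lemma sum_pairs: "(\<Sum>j<n. \<Sum>i<j. f i + f j) = (real n - 1) * (\<Sum>j<n. f j :: real)"
proof (induction n)
  case (Suc n)
  then show ?case
    by (simp add: sum.distrib algebra_simps)
qed simp

lemma cis_prod: "(\<Prod>x\<in>A. cis (f x)) = cis (\<Sum>x\<in>A. f x)"
  by (induction A rule: infinite_finite_induct) (auto simp: cis_mult)

text \<open>
  For gaps in \<open>[0, 2 \<pi>]\<close> each factor \<open>cis x\<^sub>j - cis x\<^sub>i\<close> of the Vandermonde determinant is its
  modulus times \<open>- i cis ((x\<^sub>i + x\<^sub>j) / 2)\<close>. The centring of the exponents cancels the product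
  of the half-angle phases (\<open>sum_pairs\<close>), and a power of \<open>- i\<close> that does not depend on \<open>x\<close>
  remains.
\<close>

lemma det_exponentials:
  fixes x :: "nat \<Rightarrow> real"
  assumes "\<And>i j. i < j \<Longrightarrow> j < n \<Longrightarrow> 0 \<le> x i - x j \<and> x i - x j \<le> 2 * pi"
  shows "Determinant.det (Matrix.mat n n (\<lambda>(k, j). cis ((real k - (real n - 1) / 2) * x j)))
    = (\<Prod>j<n. \<Prod>i<j. - \<i>) * of_real (\<Prod>j<n. \<Prod>i<j. cmod (cis (x i) - cis (x j)))"
proof -
  have "Determinant.det (Matrix.mat n n (\<lambda>(k, j). cis ((real k - (real n - 1) / 2) * x j)))
     = Determinant.det (Matrix.mat n n (\<lambda>(k, j). cis (- ((real n - 1) / 2) * x j) * cis (x j) ^ k))"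
  proof (rule det_mat_cong, simp only: prod.case)
    fix k j
    have "(real k - (real n - 1) / 2) * x j = - ((real n - 1) / 2) * x j + real k * x j"
      by (simp add: algebra_simps)
    then show "cis ((real k - (real n - 1) / 2) * x j) = cis (- ((real n - 1) / 2) * x j) * cis (x j) ^ k"
      by (simp only: Complex.DeMoivre cis_mult)
  qed
  also have "\<dots> = (\<Prod>j = 0..<n. cis (- ((real n - 1) / 2) * x j)) * Determinant.det (Matrix.mat n n (\<lambda>(k, j). cis (x j) ^ k))"
    by (rule det_scale_columns)
  also have "Determinant.det (Matrix.mat n n (\<lambda>(k, j). cis (x j) ^ k)) = (\<Prod>j<n. \<Prod>i<j. cis (x j) - cis (x i))"
    by (rule det_vandermonde)
  also have "\<dots> = (\<Prod>j<n. \<Prod>i<j. - \<i> * cis ((x i + x j) / 2) * of_real (cmod (cis (x i) - cis (x j))))"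
    by (intro prod.cong refl cis_diff_eq_norm) (use assms in auto)
  also have "\<dots> = (\<Prod>j<n. \<Prod>i<j. - \<i>) * (\<Prod>j<n. \<Prod>i<j. cis ((x i + x j) / 2)) * of_real (\<Prod>j<n. \<Prod>i<j. cmod (cis (x i) - cis (x j)))"
    by (simp only: prod.distrib of_real_prod)
  also have "(\<Prod>j<n. \<Prod>i<j. cis ((x i + x j) / 2)) = cis ((real n - 1) / 2 * (\<Sum>j<n. x j))"
    unfolding cis_prod sum_divide_distrib[symmetric] sum_pairs by simp
  also have "(\<Prod>j = 0..<n. cis (- ((real n - 1) / 2) * x j)) = cis (- ((real n - 1) / 2) * (\<Sum>j<n. x j))"
    unfolding cis_prod sum_distrib_left[symmetric] lessThan_atLeast0 ..
  finally show ?thesis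
    by (simp add: mult_ac cis_mult)
qed

lemma prod_minus_ii_unit: "cnj (\<Prod>j<n. \<Prod>i<j. - \<i>) * (\<Prod>j<n. \<Prod>i<j. - \<i>) = 1"
proof -
  have "cnj z * z = 1" if "cmod z = 1" for z
    using that complex_norm_square[of z] by (simp add: mult.commute)
  moreover have "cmod (\<Prod>j<n. \<Prod>i<j. - \<i>) = 1"
    by (simp add: prod_norm[symmetric] norm_power)
  ultimately show ?thesis
    by blast
qed

section \<open>The dominant frequencies\<close>

definition freq :: "nat \<Rightarrow> int \<Rightarrow> real" where
  "freq n k = real_of_int k - (real n + 1) / 2"

definition amplitude :: "nat \<Rightarrow> real \<Rightarrow> int \<Rightarrow> real" where
  "amplitude n L k = sech (freq n k * L) / (2 * pi)"

text \<open>
  Frequencies outside the window have modulus at least \<open>(n + 1) / 2\<close>, those inside at most \<open>(n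
  - 1) / 2\<close>, so each exchange costs at least 1.
\<close>

lemma freq_sum_gap:
  assumes "finite K" "card K = n" "K \<noteq> {1..int n}"
  shows "(\<Sum>k\<in>K. \<bar>freq n k\<bar>) \<ge> (\<Sum>k\<in>{1..int n}. \<bar>freq n k\<bar>) + 1"
proof -
  let ?I = "{1..int n}"
  have card: "card (K - ?I) = card (?I - K)"
    using card_Diff_subset_Int[of K ?I] card_Diff_subset_Int[of ?I K] assms
    by (simp add: Int_commute)
  have "card (?I - K) \<noteq> 0"
  proof
    assume "card (?I - K) = 0"
    then have "?I - K = {}" "K - ?I = {}"
      using card assms(1) by (metis card_eq_0_iff finite_Diff finite_atLeastAtMost_int)+
    with assms(3) show False by blast
  qed
  then have pos: "real (card (?I - K)) \<ge> 1"
    by linarith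
  have out: "real (card (K - ?I)) * ((real n + 1) / 2) \<le> (\<Sum>k\<in>K - ?I. \<bar>freq n k\<bar>)"
  proof (rule sum_bounded_below)
    fix k assume "k \<in> K - ?I"
    then have "real_of_int k \<le> 0 \<or> real_of_int k \<ge> real n + 1"
      by auto
    then show "(real n + 1) / 2 \<le> \<bar>freq n k\<bar>"
      by (auto simp: freq_def abs_if field_simps)
  qed
  have "(\<Sum>k\<in>?I - K. \<bar>freq n k\<bar>) \<le> real (card (?I - K)) * ((real n - 1) / 2)"
  proof (rule sum_bounded_above)
    fix k assume "k \<in> ?I - K"
    then have "real_of_int k \<ge> 1 \<and> real_of_int k \<le> real n"
      by auto
    then show "\<bar>freq n k\<bar> \<le> (real n - 1) / 2"
      by (auto simp: freq_def abs_le_iff field_simps)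
  qed
  moreover have "(\<Sum>k\<in>K. \<bar>freq n k\<bar>) = (\<Sum>k\<in>K \<inter> ?I. \<bar>freq n k\<bar>) + (\<Sum>k\<in>K - ?I. \<bar>freq n k\<bar>)"
    using assms(1) by (rule sum.Int_Diff)
  moreover have "(\<Sum>k\<in>?I. \<bar>freq n k\<bar>) = (\<Sum>k\<in>?I \<inter> K. \<bar>freq n k\<bar>) + (\<Sum>k\<in>?I - K. \<bar>freq n k\<bar>)"
    by (rule sum.Int_Diff) simp
  moreover have "real (card (?I - K)) * ((real n + 1) / 2) = real (card (?I - K)) * ((real n - 1) / 2) + real (card (?I - K))"
    by (simp add: field_simps)
  ultimately show ?thesis
    using out pos unfolding card Int_commute[of ?I K] by linarith
qed

lemma sech_bounds: "exp (- \<bar>x\<bar>) \<le> sech x" "sech x \<le> 2 * exp (- \<bar>x\<bar>)"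
proof -
  have c: "cosh x = cosh \<bar>x\<bar>"
    by (simp add: abs_if)
  have "cosh \<bar>x\<bar> \<le> exp \<bar>x\<bar>"
    by (simp add: cosh_def)
  then have "1 / exp \<bar>x\<bar> \<le> 1 / cosh \<bar>x\<bar>"
    by (intro divide_left_mono) auto
  then show "exp (- \<bar>x\<bar>) \<le> sech x"
    by (simp only: sech_def c exp_minus inverse_eq_divide)
  show "sech x \<le> 2 * exp (- \<bar>x\<bar>)"
    using inverse_cosh_le[of "\<bar>x\<bar>"] by (simp only: sech_def c)
qed

lemma sech_pos: "sech x > 0"
  by (simp add: sech_def)

lemma amplitude_pos: "amplitude n L k > 0"
  by (simp add: amplitude_def sech_pos)

lemma amplitude_summable:
  assumes "L > 0"
  shows "(\<lambda>k. amplitude n L k) summable_on UNIV"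
proof (rule summable_on_comparison_test)
  have "(\<lambda>k. exp (- (L * \<bar>real_of_int k + - ((real n + 1) / 2)\<bar>))) summable_on UNIV"
    by (rule summable_on_exp_abs_int[OF assms])
  then have "(\<lambda>k. exp (- (L * \<bar>freq n k\<bar>))) summable_on UNIV"
    by (simp add: freq_def)
  then show "(\<lambda>k. exp (- (L * \<bar>freq n k\<bar>)) / pi) summable_on UNIV"
    using summable_on_cmult_left[of _ UNIV "1 / pi"] by fastforce
  show "amplitude n L k \<le> exp (- (L * \<bar>freq n k\<bar>)) / pi" for k
    using sech_bounds(2)[of "freq n k * L"] assms
    by (simp add: amplitude_def field_simps abs_mult)
qed (simp add: amplitude_pos less_imp_le)

text \<open>
  Restricted to the window, the matrix is a product of two square matrices.
\<close>

lemma det_truncated: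
  "Determinant.det (Matrix.mat n n (\<lambda>(i, j). \<Sum>k\<in>{1..int n}.
      of_real (amplitude n L k) * cis (- (freq n k * x i)) * cis (freq n k * y j)))
   = of_real (\<Prod>k\<in>{1..int n}. amplitude n L k) *
     (cnj (Determinant.det (Matrix.mat n n (\<lambda>(k, j). cis ((real k - (real n - 1) / 2) * x j)))) *
      Determinant.det (Matrix.mat n n (\<lambda>(k, j). cis ((real k - (real n - 1) / 2) * y j))))"
proof -
  have bij: "bij_betw (\<lambda>l. int l + 1) {0..<n} {1..int n}"
    by (rule bij_betwI[of _ _ _ "\<lambda>k. nat (k - 1)"]) auto
  have freq: "freq n (int l + 1) = real l - (real n - 1) / 2" for l
    by (simp add: freq_def field_simps)
  define c where "c l = complex_of_real (amplitude n L (int l + 1))" for l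
  define w where "w l t = cis ((real l - (real n - 1) / 2) * t)" for l t
  let ?A = "Matrix.mat n n (\<lambda>(i, l). c l * cnj (w l (x i)))"
  let ?B = "Matrix.mat n n (\<lambda>(l, j). w l (y j))"
  have "Matrix.mat n n (\<lambda>(i, j). \<Sum>k\<in>{1..int n}.
      of_real (amplitude n L k) * cis (- (freq n k * x i)) * cis (freq n k * y j)) = ?A * ?B"
  proof (rule eq_matI)
    fix i j assume "i < dim_row (?A * ?B)" "j < dim_col (?A * ?B)"
    then have ij: "i < n" "j < n" by auto
    then have "(?A * ?B) $$ (i, j) = (\<Sum>l = 0..<n. c l * cnj (w l (x i)) * w l (y j))"
      by (simp add: scalar_prod_def)
    also have "\<dots> = (\<Sum>k\<in>{1..int n}.
      of_real (amplitude n L k) * cis (- (freq n k * x i)) * cis (freq n k * y j))"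
      by (subst sum.reindex_bij_betw[OF bij, symmetric]) (simp add: c_def w_def freq cis_cnj)
    finally show "Matrix.mat n n (\<lambda>(i, j). \<Sum>k\<in>{1..int n}.
      of_real (amplitude n L k) * cis (- (freq n k * x i)) * cis (freq n k * y j)) $$ (i, j) = (?A * ?B) $$ (i, j)"
      using ij by simp
  qed auto
  then have "Determinant.det (Matrix.mat n n (\<lambda>(i, j). \<Sum>k\<in>{1..int n}.
      of_real (amplitude n L k) * cis (- (freq n k * x i)) * cis (freq n k * y j))) = Determinant.det ?A * Determinant.det ?B"
    using det_mult[of ?A n ?B] by simp
  also have "Determinant.det ?A = (\<Prod>l = 0..<n. c l) * Determinant.det (Matrix.mat n n (\<lambda>(i, l). cnj (w l (x i))))"
    by (rule det_scale_columns)
  also have "Determinant.det (Matrix.mat n n (\<lambda>(i, l). cnj (w l (x i)))) =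
      Determinant.det (Matrix.mat n n (\<lambda>(l, i). cnj (w l (x i))))"
    by (rule det_swap_indices)
  also have "\<dots> = cnj (Determinant.det (Matrix.mat n n (\<lambda>(l, i). w l (x i))))"
    by (rule det_cnj)
  also have "(\<Prod>l = 0..<n. c l) = of_real (\<Prod>k\<in>{1..int n}. amplitude n L k)"
    unfolding of_real_prod c_def
    by (rule prod.reindex_bij_betw[OF bij, of "\<lambda>k. complex_of_real (amplitude n L k)"])
  finally show ?thesis
    by (simp add: w_def mult_ac)
qed

text \<open>
  The difference is the sum of the row expansion over the assignments \<open>g\<close> that leave the
  window. Such a \<open>g\<close> either repeats a frequency, and then two rows coincide, or, by
  \<open>freq_sum_gap\<close>, has \<open>T = \<Sum> |m| \<ge> S + 1\<close>, where \<open>S\<close> is the value for the window.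
  Splitting \<open>L T = (L - 1) T + T\<close> leaves one factor \<open>exp (- T)\<close> to sum over all \<open>g\<close> and turns
  the rest into \<open>exp (- L S) exp (- L)\<close> up to a constant; \<open>exp (- L S)\<close> is absorbed by the
  weight of the window, as \<open>sech x \<ge> exp (- |x|)\<close>.
\<close>

lemma det_infinite_minus_truncated:
  obtains C where "C \<ge> 0" and
    "\<And>L x y. L \<ge> 1 \<Longrightarrow>
      cmod (Determinant.det (Matrix.mat n n (\<lambda>(i, j). \<Sum>\<^sub>\<infinity>k.
               of_real (amplitude n L k) * cis (- (freq n k * x i)) * cis (freq n k * y j))) -
            Determinant.det (Matrix.mat n n (\<lambda>(i, j). \<Sum>k\<in>{1..int n}.
               of_real (amplitude n L k) * cis (- (freq n k * x i)) * cis (freq n k * y j))))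
      \<le> (\<Prod>k\<in>{1..int n}. amplitude n L k) * (C * exp (- L))"
proof -
  let ?I = "{1..int n}" and ?U = "PiE {0..<n} (\<lambda>_. UNIV :: int set)"
  define S where "S = (\<Sum>k\<in>?I. \<bar>freq n k\<bar>)"
  define w where "w = (\<lambda>g :: nat \<Rightarrow> int. \<Prod>i = 0..<n. exp (- \<bar>freq n (g i)\<bar>))"
  have "(\<lambda>k. norm (complex_of_real (exp (- (1 * \<bar>real_of_int k + - ((real n + 1) / 2)\<bar>))))) summable_on UNIV"
    using summable_on_exp_abs_int[of 1 "- ((real n + 1) / 2)"] by simp
  then have "(\<lambda>g. norm (\<Prod>i = 0..<n. complex_of_real (exp (- \<bar>freq n (g i)\<bar>)))) summable_on ?U"
    by (intro abs_summable_on_prod_PiE) (auto simp: freq_def)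
  then have w: "w summable_on ?U"
    by (simp add: w_def prod_norm[symmetric] abs_prod)
  have w_nonneg: "w g \<ge> 0" for g
    by (simp add: w_def prod_nonneg)
  define C where "C = 2 ^ n * fact n * exp (S + 1) * infsum w ?U"
  show ?thesis
  proof
    show "C \<ge> 0"
      by (auto simp: C_def intro!: mult_nonneg_nonneg infsum_nonneg w_nonneg)
  next
    fix L :: real and x y :: "nat \<Rightarrow> real"
    assume L: "L \<ge> 1"
    define u where "u i k = complex_of_real (amplitude n L k) * cis (- (freq n k * x i))" for i k
    define v where "v k j = cis (freq n k * y j)" for k j
    define t where "t g = (\<Prod>i = 0..<n. u i (g i)) * Determinant.det (Matrix.mat n n (\<lambda>(i, j). v (g i) j))" for g
    define lead where "lead = (\<Prod>k\<in>?I. amplitude n L k)"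
    have "norm (u i k * v k j) = amplitude n L k" for i j k
      using amplitude_pos[of n L k] by (simp add: u_def v_def norm_mult)
    then have summ: "(\<lambda>k. norm (u i k * v k j)) summable_on K" for i j K
      using summable_on_subset_banach[OF amplitude_summable] L by auto
    have "(t has_sum Determinant.det (Matrix.mat n n (\<lambda>(i, j). \<Sum>\<^sub>\<infinity>k. u i k * v k j))) ?U"
      unfolding t_def using summ by (rule det_row_expansion)
    moreover have "(t has_sum Determinant.det (Matrix.mat n n (\<lambda>(i, j). \<Sum>\<^sub>\<infinity>k\<in>?I. u i k * v k j))) (PiE {0..<n} (\<lambda>_. ?I))"
      unfolding t_def using summ by (rule det_row_expansion)
    ultimately have diff: "(t has_sum (Determinant.det (Matrix.mat n n (\<lambda>(i, j). \<Sum>\<^sub>\<infinity>k. u i k * v k j)) -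
        Determinant.det (Matrix.mat n n (\<lambda>(i, j). \<Sum>k\<in>?I. u i k * v k j)))) (?U - PiE {0..<n} (\<lambda>_. ?I))"
      by (intro has_sum_Diff) (auto simp: PiE_mono)
    have lead: "lead \<ge> (1 / (2 * pi)) ^ n * exp (- (L * S))"
    proof -
      have "(1 / (2 * pi)) ^ n * exp (- (L * S)) = (\<Prod>k\<in>?I. exp (- (L * \<bar>freq n k\<bar>)) / (2 * pi))"
        by (simp add: S_def exp_sum sum_distrib_left sum_negf[symmetric] prod_dividef power_one_over divide_simps)
      also have "\<dots> \<le> lead"
        unfolding lead_def
      proof (intro prod_mono conjI)
        show "exp (- (L * \<bar>freq n k\<bar>)) / (2 * pi) \<le> amplitude n L k" for k
          using sech_bounds(1)[of "freq n k * L"] L by (simp add: amplitude_def abs_mult mult.commute divide_right_mono)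
      qed simp
      finally show ?thesis .
    qed
    have bound: "norm (t g) \<le> lead * (2 ^ n * fact n * exp (S + 1) * exp (- L)) * w g"
      if g: "g \<in> ?U - PiE {0..<n} (\<lambda>_. ?I)" for g
    proof (cases "inj_on g {0..<n}")
      case False
      then obtain i j where ij: "i < n" "j < n" "i \<noteq> j" "g i = g j"
        by (auto simp: inj_on_def)
      have "Determinant.det (Matrix.mat n n (\<lambda>(i, j). v (g i) j)) = 0"
        by (rule det_identical_rows[of _ n i j]) (use ij in auto)
      then have "t g = 0"
        by (simp add: t_def)
      moreover have "lead \<ge> 0"
        unfolding lead_def by (intro prod_nonneg) (simp add: amplitude_pos less_imp_le)
      ultimately show ?thesis
        by (auto intro!: mult_nonneg_nonneg w_nonneg)
    next
      case True
      define T where "T = (\<Sum>i = 0..<n. \<bar>freq n (g i)\<bar>)"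
      have "g ` {0..<n} \<noteq> ?I"
        using g by (auto simp: PiE_iff)
      then have "T \<ge> S + 1"
        using freq_sum_gap[of "g ` {0..<n}" n] True
        by (simp add: T_def S_def card_image sum.reindex)
      then have "(L - 1) * (S + 1) \<le> (L - 1) * T"
        using L by (intro mult_left_mono) auto
      then have exps: "- (L * T) \<le> - (L * S) + (S + 1) + (- L) + (- T)"
        by (simp add: algebra_simps)
      have wg: "w g = exp (- T)"
        by (simp add: w_def T_def exp_sum sum_negf[symmetric])
      have "norm (\<Prod>i = 0..<n. u i (g i)) = (\<Prod>i = 0..<n. amplitude n L (g i))"
        using amplitude_pos[of n L] by (simp add: prod_norm[symmetric] u_def norm_mult abs_of_pos)
      also have "\<dots> \<le> (\<Prod>i = 0..<n. (1 / (2 * pi)) * 2 * exp (- (L * \<bar>freq n (g i)\<bar>)))"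
      proof (intro prod_mono conjI)
        show "amplitude n L (g i) \<le> (1 / (2 * pi)) * 2 * exp (- (L * \<bar>freq n (g i)\<bar>))" for i
          using sech_bounds(2)[of "freq n (g i) * L"] L
          by (simp add: amplitude_def abs_mult mult.commute field_simps)
      qed (simp add: amplitude_pos less_imp_le)
      also have "\<dots> = (1 / (2 * pi)) ^ n * 2 ^ n * exp (- (L * T))"
      proof -
        have "exp (- (L * T)) = (\<Prod>i = 0..<n. exp (- (L * \<bar>freq n (g i)\<bar>)))"
          by (simp add: T_def exp_sum sum_distrib_left sum_negf[symmetric])
        then show ?thesis
          by (simp only: prod.distrib prod_constant card_atLeastLessThan diff_zero)
      qed
      also have "\<dots> \<le> (1 / (2 * pi)) ^ n * 2 ^ n * (exp (- (L * S)) * exp (S + 1) * exp (- L) * w g)"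
        unfolding wg exp_add[symmetric] using exps by (intro mult_left_mono) auto
      also have "\<dots> = (1 / (2 * pi)) ^ n * exp (- (L * S)) * (2 ^ n * exp (S + 1) * exp (- L) * w g)"
        by (simp add: mult_ac)
      also have "\<dots> \<le> lead * (2 ^ n * exp (S + 1) * exp (- L) * w g)"
        by (intro mult_right_mono lead mult_nonneg_nonneg w_nonneg) auto
      finally have 1: "norm (\<Prod>i = 0..<n. u i (g i)) \<le> lead * (2 ^ n * exp (S + 1) * exp (- L) * w g)" .
      have "norm (Determinant.det (Matrix.mat n n (\<lambda>(i, j). v (g i) j))) \<le> fact n"
        by (rule norm_det_mat_le) (simp add: v_def)
      then have "norm (t g) \<le> lead * (2 ^ n * exp (S + 1) * exp (- L) * w g) * fact n"
        unfolding t_def norm_mult using 1 by (intro mult_mono) (auto intro: order_trans[OF norm_ge_zero])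
      then show ?thesis
        by (simp add: mult_ac)
    qed
    have "(w has_sum infsum w (?U - PiE {0..<n} (\<lambda>_. ?I))) (?U - PiE {0..<n} (\<lambda>_. ?I))"
      by (intro has_sum_infsum summable_on_subset_banach[OF w]) auto
    then have "norm (Determinant.det (Matrix.mat n n (\<lambda>(i, j). \<Sum>\<^sub>\<infinity>k. u i k * v k j)) -
        Determinant.det (Matrix.mat n n (\<lambda>(i, j). \<Sum>k\<in>?I. u i k * v k j)))
        \<le> lead * (2 ^ n * fact n * exp (S + 1) * exp (- L)) * infsum w (?U - PiE {0..<n} (\<lambda>_. ?I))"
      using norm_infsum_le[OF diff has_sum_cmult_right bound] by blast
    also have "\<dots> \<le> lead * (2 ^ n * fact n * exp (S + 1) * exp (- L)) * infsum w ?U"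
    proof (intro mult_left_mono)
      show "infsum w (?U - PiE {0..<n} (\<lambda>_. ?I)) \<le> infsum w ?U"
        by (intro infsum_mono_neutral summable_on_subset_banach[OF w] w) (auto simp: w_nonneg)
      show "lead * (2 ^ n * fact n * exp (S + 1) * exp (- L)) \<ge> 0"
        unfolding lead_def by (intro mult_nonneg_nonneg prod_nonneg) (simp_all add: amplitude_pos less_imp_le)
    qed
    also have "\<dots> = lead * (C * exp (- L))"
      by (simp add: C_def mult_ac)
    finally show "cmod (Determinant.det (Matrix.mat n n (\<lambda>(i, j). \<Sum>\<^sub>\<infinity>k.
               of_real (amplitude n L k) * cis (- (freq n k * x i)) * cis (freq n k * y j))) -
            Determinant.det (Matrix.mat n n (\<lambda>(i, j). \<Sum>k\<in>{1..int n}.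
               of_real (amplitude n L k) * cis (- (freq n k * x i)) * cis (freq n k * y j))))
      \<le> (\<Prod>k\<in>{1..int n}. amplitude n L k) * (C * exp (- L))"
      by (simp add: u_def v_def lead_def)
  qed
qed

section \<open>Asymptotics of the determinant\<close>

definition kernel :: "nat \<Rightarrow> real \<Rightarrow> real \<Rightarrow> complex" where
  "kernel n L t = (\<Sum>\<^sub>\<infinity>k. of_real (amplitude n L k) * cis (freq n k * t))"

lemma continuous_kernel:
  assumes "L > 0"
  shows "continuous_on UNIV (kernel n L)"
proof -
  have "uniform_limit UNIV (\<lambda>X t. \<Sum>k\<in>X. of_real (amplitude n L k) * cis (freq n k * t))
      (\<lambda>t. \<Sum>\<^sub>\<infinity>k. of_real (amplitude n L k) * cis (freq n k * t)) (finite_subsets_at_top UNIV)"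
    by (rule Weierstrass_m_test_general[OF _ amplitude_summable[OF assms, of n]])
       (simp add: norm_mult abs_of_pos amplitude_pos)
  then show ?thesis
    unfolding kernel_def[abs_def]
    by (rule uniform_limit_theorem[rotated]) (auto intro!: always_eventually continuous_intros)
qed

text \<open>
  Poisson summation with \<open>y = 1 - twist n\<close>, which lies in \<open>(0, 1]\<close>. The two conventions for the
  twist agree because \<open>twist n + y\<close> is an integer, and \<open>y + \<int>\<close> is the set of all frequencies \<open>k
  - (n + 1) / 2\<close>.
\<close>

lemma entry_eq_kernel:
  assumes "0 < r" "r < 1"
  shows "(\<Sum>\<^sub>\<infinity>k\<in>(UNIV :: int set). exp (\<i> * complex_of_real (2 * pi * twist n * real_of_int k)) *
       complex_of_real (h r \<theta> (\<nu> + 2 * pi * real_of_int k))) = kernel n \<bar>ln r\<bar> (\<nu> - \<theta>)"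
proof -
  define L where "L = \<bar>ln r\<bar>"
  define y where "y = 1 - twist n"
  have L: "L > 0" and y: "0 < y" "y \<le> 1"
    using assms by (simp_all add: L_def y_def twist_def)
  have "exp (\<i> * complex_of_real (2 * pi * twist n * real_of_int k)) *
       complex_of_real (h r \<theta> (\<nu> + 2 * pi * real_of_int k)) =
      exp (- (\<i> * of_real (2 * pi * y * of_int k))) *
      sech_density L (of_real (\<nu> - \<theta>) + of_real (2 * pi * of_int k))" for k
  proof -
    have "exp (\<i> * complex_of_real (2 * pi * twist n * real_of_int k)) =
       exp (- (\<i> * of_real (2 * pi * y * of_int k)) + 2 * of_int k * pi * \<i>)"
      by (simp add: y_def algebra_simps)
    also have "\<dots> = exp (- (\<i> * of_real (2 * pi * y * of_int k)))"
      using exp_integer_2pi[of "of_int k"] by (simp only: exp_add) (simp add: mult_ac)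
    finally have 1: "exp (\<i> * complex_of_real (2 * pi * twist n * real_of_int k)) =
       exp (- (\<i> * of_real (2 * pi * y * of_int k)))" .
    have "of_real (pi / (2 * L)) * (of_real (\<nu> - \<theta>) + of_real (2 * pi * of_int k)) =
        complex_of_real (pi / (2 * L) * (\<nu> + 2 * pi * real_of_int k - \<theta>))"
      by (simp add: algebra_simps)
    moreover have "cosh (complex_of_real x) = of_real (cosh x)" for x
      by (simp add: cosh_def exp_of_real[symmetric] scaleR_conv_of_real)
    ultimately have 2: "complex_of_real (h r \<theta> (\<nu> + 2 * pi * real_of_int k)) =
        sech_density L (of_real (\<nu> - \<theta>) + of_real (2 * pi * of_int k))"
      by (simp only: sech_density_def) (simp add: h_def sech_def L_def)
    show ?thesis
      unfolding 1 2 ..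
  qed
  then have "(\<Sum>\<^sub>\<infinity>k\<in>(UNIV :: int set). exp (\<i> * complex_of_real (2 * pi * twist n * real_of_int k)) *
       complex_of_real (h r \<theta> (\<nu> + 2 * pi * real_of_int k))) = twisted_sum L y (\<nu> - \<theta>)"
    unfolding twisted_sum_def by simp
  also have "((\<lambda>k. 1 / (2 * pi) * (of_real (1 / cosh ((real_of_int k + y) * L)) *
            exp (\<i> * of_real (real_of_int k + y) * (\<nu> - \<theta>)))) has_sum twisted_sum L y (\<nu> - \<theta>)) UNIV"
    using poisson_summation_sech[OF L y, of "\<nu> - \<theta>"] by simp
  then have "twisted_sum L y (\<nu> - \<theta>) = (\<Sum>\<^sub>\<infinity>k. 1 / (2 * pi) * (of_real (1 / cosh ((real_of_int k + y) * L)) *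
            exp (\<i> * of_real (real_of_int k + y) * (\<nu> - \<theta>))))"
    by (simp add: has_sum_iff)
  also have "\<dots> = (\<Sum>\<^sub>\<infinity>k. of_real (amplitude n L k) * cis (freq n k * (\<nu> - \<theta>)))"
  proof -
    \<comment> \<open>The index shift for which \<open>k - c + y = k - (n + 1) / 2\<close>.\<close>
    define c where "c = (if odd n then int (n div 2) + 2 else int (n div 2) + 1)"
    have f: "real_of_int (k - c) + y = freq n k" for k
    proof (cases "odd n")
      case True
      then obtain m where "n = 2 * m + 1" by (rule oddE)
      then show ?thesis
        by (simp add: c_def y_def twist_def freq_def field_simps)
    next
      case False
      then obtain m where "n = 2 * m" by (auto elim: evenE)
      then show ?thesis
        by (simp add: c_def y_def twist_def freq_def field_simps)
    qed
    have "bij_betw (\<lambda>k. k - c) UNIV UNIV"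
      by (rule bij_betwI[of _ _ _ "\<lambda>k. k + c"]) auto
    from infsum_reindex_bij_betw[OF this, symmetric]
    have "(\<Sum>\<^sub>\<infinity>k. 1 / (2 * pi) * (of_real (1 / cosh ((real_of_int k + y) * L)) *
            exp (\<i> * of_real (real_of_int k + y) * (\<nu> - \<theta>)))) =
      (\<Sum>\<^sub>\<infinity>k. 1 / (2 * pi) * (of_real (1 / cosh ((real_of_int (k - c) + y) * L)) *
            exp (\<i> * of_real (real_of_int (k - c) + y) * (\<nu> - \<theta>))))" .
    then show ?thesis
      unfolding f by (simp add: amplitude_def sech_def cis_conv_exp mult_ac)
  qed
  finally show ?thesis
    by (simp add: kernel_def L_def)
qed

lemma H_eq_det_kernel:
  assumes "0 < r" "r < 1"
  shows "H n r \<theta> \<nu> = Determinant.det (Matrix.mat n n (\<lambda>(i, j). kernel n \<bar>ln r\<bar> (\<nu> (Suc j) - \<theta> (Suc i))))"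
  unfolding H_def entry_eq_kernel[OF assms] ..

lemma alcove_difference:
  assumes "\<nu> \<in> alcove n" "1 \<le> i" "i < j" "j \<le> n"
  shows "0 < \<nu> i - \<nu> j" "\<nu> i - \<nu> j < 2 * pi"
proof -
  have dec: "\<nu> l < \<nu> k" if "1 \<le> k" "k < l" "l \<le> n" for k l
    using that(2,1,3)
  proof (induction rule: strict_inc_induct[where i = k and j = l])
    case (base k)
    then show ?case using assms(1) by (auto simp: alcove_def)
  next
    case (step k)
    then have "\<nu> (Suc k) < \<nu> k"
      using assms(1) by (auto simp: alcove_def)
    then show ?case using step by simp
  qed
  have dec': "\<nu> l \<le> \<nu> k" if "1 \<le> k" "k \<le> l" "l \<le> n" for k l
    using dec[of k l] that by (cases "k = l") auto
  show "0 < \<nu> i - \<nu> j"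
    using dec assms by simp
  have "\<nu> i \<le> \<nu> 1" "\<nu> n \<le> \<nu> j" "\<nu> 1 < \<nu> n + 2 * pi"
    using dec' assms by (auto simp: alcove_def)
  then show "\<nu> i - \<nu> j < 2 * pi"
    by linarith
qed

lemma vandermonde_abs_eq:
  "vandermonde_abs n \<nu> = (\<Prod>j<n. \<Prod>i<j. cmod (cis (\<nu> (Suc i)) - cis (\<nu> (Suc j))))"
proof -
  have "(\<Prod>j<n. \<Prod>i<j. cmod (cis (\<nu> (Suc i)) - cis (\<nu> (Suc j)))) =
      (\<Prod>(j, i)\<in>(SIGMA j:{..<n}. {..<j}). cmod (cis (\<nu> (Suc i)) - cis (\<nu> (Suc j))))"
    by (rule prod.Sigma) auto
  also have "\<dots> = vandermonde_abs n \<nu>"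
    unfolding vandermonde_abs_def
    by (rule prod.reindex_bij_witness[of _ "\<lambda>(i, j). (j - 1, i - 1)" "\<lambda>(j, i). (Suc i, Suc j)"]) auto
  finally show ?thesis ..
qed

lemma vandermonde_abs_pos:
  assumes "\<nu> \<in> alcove n"
  shows "vandermonde_abs n \<nu> > 0"
  unfolding vandermonde_abs_eq
proof (intro prod_pos ballI)
  fix i j assume "j \<in> {..<n}" "i \<in> {..<j}"
  then have d: "0 < \<nu> (Suc i) - \<nu> (Suc j)" "\<nu> (Suc i) - \<nu> (Suc j) < 2 * pi"
    using alcove_difference[OF assms, of "Suc i" "Suc j"] by auto
  then have "sin ((\<nu> (Suc i) - \<nu> (Suc j)) / 2) > 0"
    by (intro sin_gt_zero) auto
  then have "cis (\<nu> (Suc j)) - cis (\<nu> (Suc i)) \<noteq> 0"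
    unfolding cis_diff by simp
  then show "cmod (cis (\<nu> (Suc i)) - cis (\<nu> (Suc j))) > 0"
    by auto
qed

lemma vandermonde_abs_le: "vandermonde_abs n \<nu> \<le> (\<Prod>j<n. \<Prod>i<j. 2)"
  unfolding vandermonde_abs_eq
proof (intro prod_mono conjI prod_nonneg)
  show "cmod (cis (\<nu> (Suc i)) - cis (\<nu> (Suc j))) \<le> 2" for i j
    using norm_triangle_ineq4[of "cis (\<nu> (Suc i))" "cis (\<nu> (Suc j))"] by simp
qed auto

lemma leading_factor_eq:
  "leading_factor n r \<theta> = (\<Prod>k\<in>{1..int n}. amplitude n \<bar>ln r\<bar> k) * vandermonde_abs n \<theta>"
proof -
  have bij: "bij_betw int {1..n} {1..int n}"
    by (rule bij_betwI[of _ _ _ nat]) auto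
  have "(\<Prod>k\<in>{1..int n}. amplitude n \<bar>ln r\<bar> k) = (\<Prod>k = 1..n. amplitude n \<bar>ln r\<bar> (int k))"
    by (rule prod.reindex_bij_betw[OF bij, symmetric])
  also have "\<dots> = (1 / (2 * pi)) ^ n * (\<Prod>k = 1..n. sech ((real k - (real n + 1) / 2) * \<bar>ln r\<bar>))"
    by (simp add: amplitude_def freq_def prod_dividef power_one_over)
  finally show ?thesis
    by (simp add: leading_factor_def)
qed

lemma leading_factor_pos: "\<theta> \<in> alcove n \<Longrightarrow> leading_factor n r \<theta> > 0"
  by (simp add: leading_factor_eq vandermonde_abs_pos prod_pos amplitude_pos)

text \<open>
  The bound is uniform in \<open>\<nu>\<close>, which is what allows integration over the chamber. The error
  \<open>exp (- L)\<close> is \<open>r\<close> itself.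
\<close>

lemma H_asymptotics:
  assumes \<theta>: "\<theta> \<in> alcove n"
  obtains C where "C \<ge> 0" and
    "\<And>r \<nu>. 0 < r \<Longrightarrow> r \<le> exp (- 1) \<Longrightarrow> \<nu> \<in> alcove n \<Longrightarrow>
      cmod (H n r \<theta> \<nu> / of_real (leading_factor n r \<theta>) - of_real (vandermonde_abs n \<nu>)) \<le> C * r"
proof -
  obtain C where C: "C \<ge> 0" and bound:
    "\<And>L x y. L \<ge> 1 \<Longrightarrow>
      cmod (Determinant.det (Matrix.mat n n (\<lambda>(i, j). \<Sum>\<^sub>\<infinity>k.
               of_real (amplitude n L k) * cis (- (freq n k * x i)) * cis (freq n k * y j))) -
            Determinant.det (Matrix.mat n n (\<lambda>(i, j). \<Sum>k\<in>{1..int n}.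
               of_real (amplitude n L k) * cis (- (freq n k * x i)) * cis (freq n k * y j))))
      \<le> (\<Prod>k\<in>{1..int n}. amplitude n L k) * (C * exp (- L))"
    by (rule det_infinite_minus_truncated[of n], rule that)
  define V where "V = vandermonde_abs n \<theta>"
  have V: "V > 0"
    using vandermonde_abs_pos[OF \<theta>] by (simp add: V_def)
  show ?thesis
  proof
    show "C / V \<ge> 0"
      using C V by simp
  next
    fix r :: real and \<nu> assume r: "0 < r" "r \<le> exp (- 1)" and \<nu>: "\<nu> \<in> alcove n"
    define L where "L = \<bar>ln r\<bar>"
    define lead where "lead = (\<Prod>k\<in>{1..int n}. amplitude n L k)"
    have lead: "lead > 0"
      unfolding lead_def by (intro prod_pos) (simp add: amplitude_pos)
    have "exp (- 1 :: real) < 1"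
      by simp
    with r have "r < 1"
      by linarith
    have "ln r \<le> -1"
      using r by (metis ln_exp ln_le_cancel_iff exp_gt_zero)
    then have L_eq: "L = - ln r"
      by (simp add: L_def)
    then have L: "L \<ge> 1" "exp (- L) = r"
      using \<open>ln r \<le> -1\<close> r(1) by simp_all
    let ?x = "\<lambda>i. \<theta> (Suc i)" and ?y = "\<lambda>j. \<nu> (Suc j)"
    let ?Q = "\<lambda>x. Determinant.det (Matrix.mat n n (\<lambda>(k, j). cis ((real k - (real n - 1) / 2) * x j)))"
    have Q: "?Q (\<lambda>i. \<mu> (Suc i)) = (\<Prod>j<n. \<Prod>i<j. - \<i>) * of_real (vandermonde_abs n \<mu>)" if "\<mu> \<in> alcove n" for \<mu>
      unfolding vandermonde_abs_eq
      by (rule det_exponentials) (use alcove_difference[OF that] in \<open>force intro: less_imp_le\<close>)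
    have split: "of_real (amplitude n L k) * cis (freq n k * (\<nu> (Suc j) - \<theta> (Suc i))) =
       of_real (amplitude n L k) * cis (- (freq n k * ?x i)) * cis (freq n k * ?y j)" for k i j
      by (simp add: mult.assoc cis_mult algebra_simps)
    have H: "H n r \<theta> \<nu> = Determinant.det (Matrix.mat n n (\<lambda>(i, j). \<Sum>\<^sub>\<infinity>k.
               of_real (amplitude n L k) * cis (- (freq n k * ?x i)) * cis (freq n k * ?y j)))"
      unfolding H_eq_det_kernel[OF r(1) \<open>r < 1\<close>] kernel_def L_def[symmetric] split ..
    have "cnj (?Q ?x) * ?Q ?y = of_real (V * vandermonde_abs n \<nu>)"
    proof -
      have "cnj (?Q ?x) * ?Q ?y = cnj (\<Prod>j<n. \<Prod>i<j. - \<i>) * (\<Prod>j<n. \<Prod>i<j. - \<i>) * of_real (V * vandermonde_abs n \<nu>)"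
        unfolding Q[OF \<theta>] Q[OF \<nu>] V_def complex_cnj_mult complex_cnj_complex_of_real of_real_mult
        by (simp only: mult_ac)
      then show ?thesis
        by (simp only: prod_minus_ii_unit mult_1_left)
    qed
    then have "cmod (H n r \<theta> \<nu> - of_real lead * of_real (V * vandermonde_abs n \<nu>)) \<le> lead * (C * r)"
      using bound[OF L(1), of ?x ?y] unfolding H det_truncated lead_def L(2) by simp
    then have "cmod (H n r \<theta> \<nu> - of_real lead * of_real (V * vandermonde_abs n \<nu>)) / (lead * V) \<le> C / V * r"
      using lead V by (simp add: field_simps)
    moreover have "H n r \<theta> \<nu> / of_real (lead * V) - of_real (vandermonde_abs n \<nu>) =
       (H n r \<theta> \<nu> - of_real lead * of_real (V * vandermonde_abs n \<nu>)) / of_real (lead * V)"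
      using lead V by (simp add: field_simps)
    moreover have "leading_factor n r \<theta> = lead * V"
      by (simp add: leading_factor_eq lead_def L_def V_def)
    ultimately show "cmod (H n r \<theta> \<nu> / of_real (leading_factor n r \<theta>) - of_real (vandermonde_abs n \<nu>)) \<le> C / V * r"
      using lead V by (simp add: norm_divide norm_mult)
  qed
qed

section \<open>Measure of the chamber and the limits\<close>

lemma measurable_coordinate:
  assumes "i \<in> {1..n}"
  shows "(\<lambda>\<nu>. \<nu> i) \<in> borel_measurable (leb n)"
proof -
  have "(\<lambda>\<nu>. \<nu> i) \<in> measurable (leb n) lborel"
    unfolding leb_def using assms by (rule measurable_component_singleton)
  then show ?thesis
    by simp
qed

lemma H_measurable:
  assumes "0 < r" "r < 1"
  shows "H n r \<theta> \<in> borel_measurable (leb n)"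
proof -
  have "kernel n \<bar>ln r\<bar> \<in> borel_measurable borel"
    using assms by (intro borel_measurable_continuous_onI continuous_kernel) auto
  then have k: "(\<lambda>\<nu>. kernel n \<bar>ln r\<bar> (\<nu> (Suc j) - \<theta> (Suc i))) \<in> borel_measurable (leb n)" if "j < n" for i j
    by (rule measurable_compose[rotated]) (use that in \<open>auto intro!: borel_measurable_diff measurable_coordinate\<close>)
  have "(\<lambda>\<nu>. H n r \<theta> \<nu>) \<in> borel_measurable (leb n)"
    unfolding H_eq_det_kernel[OF assms] det_mat prod.case
  proof (intro borel_measurable_sum borel_measurable_times borel_measurable_prod borel_measurable_const k)
    fix p i assume "p \<in> {p. p permutes {0..<n}}" "i \<in> {0..<n}"
    then show "p i < n"
      using permutes_in_image[of p "{0..<n}" i] by auto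
  qed
  then show ?thesis
    by simp
qed

lemma vandermonde_abs_measurable: "vandermonde_abs n \<in> borel_measurable (leb n)"
proof -
  have c: "(\<lambda>\<nu>. cis (\<nu> i)) \<in> borel_measurable (leb n)" if "i \<in> {1..n}" for i
    by (rule measurable_compose[OF measurable_coordinate[OF that]])
       (auto intro!: borel_measurable_continuous_onI continuous_intros)
  have "(\<lambda>\<nu>. vandermonde_abs n \<nu>) \<in> borel_measurable (leb n)"
    unfolding vandermonde_abs_eq
    by (intro borel_measurable_prod measurable_compose[OF _ borel_measurable_norm] borel_measurable_diff c) auto
  then show ?thesis
    by simp
qed

lemma space_leb: "space (leb n) = RR n"
  by (simp add: leb_def space_PiM)

lemma emeasure_leb_box:
  "emeasure (leb n) (PiE {1..n} (\<lambda>i. {a i..b i})) = (\<Prod>i\<in>{1..n}. emeasure lborel {a i..b i})"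
proof -
  interpret product_sigma_finite "\<lambda>_. lborel :: real measure"
    by standard
  show ?thesis
    unfolding leb_def by (rule emeasure_PiM) auto
qed

lemma chamber_sets: "n \<ge> 1 \<Longrightarrow> chamber n \<in> sets (leb n)"
proof -
  assume n: "n \<ge> 1"
  note c [measurable] = measurable_coordinate
  have "chamber n = {\<nu> \<in> space (leb n). (\<forall>i\<in>{1..<n}. \<nu> (Suc i) < \<nu> i) \<and> \<nu> 1 < \<nu> n + 2 * pi \<and> - pi \<le> \<nu> n \<and> \<nu> n < pi}"
    by (auto simp: chamber_def alcove_def space_leb)
  also have "\<dots> \<in> sets (leb n)"
  proof -
    have "{\<nu> \<in> space (leb n). \<nu> (Suc i) < \<nu> i} \<in> sets (leb n)" if "i \<in> {1..<n}" for i
      using that by (intro borel_measurable_less measurable_coordinate) auto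
    moreover have "{\<nu> \<in> space (leb n). \<nu> 1 < \<nu> n + 2 * pi} \<in> sets (leb n)"
      using n by (intro borel_measurable_less borel_measurable_add measurable_coordinate borel_measurable_const) auto
    moreover have "{\<nu> \<in> space (leb n). - pi \<le> \<nu> n} \<in> sets (leb n)"
      using n by (intro borel_measurable_le measurable_coordinate borel_measurable_const) auto
    moreover have "{\<nu> \<in> space (leb n). \<nu> n < pi} \<in> sets (leb n)"
      using n by (intro borel_measurable_less measurable_coordinate borel_measurable_const) auto
    ultimately show ?thesis
      by (intro sets.sets_Collect) auto
  qed
  finally show ?thesis .
qed

lemma chamber_finite_measure:
  assumes "n \<ge> 1"
  shows "emeasure (leb n) (chamber n) < \<infinity>"
proof -
  have "chamber n \<subseteq> PiE {1..n} (\<lambda>_. {- pi..3 * pi})"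
  proof
    fix \<nu> assume \<nu>: "\<nu> \<in> chamber n"
    then have n: "- pi \<le> \<nu> n" "\<nu> n < pi" and a: "\<nu> \<in> alcove n"
      by (auto simp: chamber_def)
    have "- pi \<le> \<nu> i \<and> \<nu> i \<le> 3 * pi" if "i \<in> {1..n}" for i
    proof (cases "i = n")
      case False
      then show ?thesis
        using alcove_difference[OF a, of i n] that n by auto
    qed (use n pi_gt_zero in auto)
    then show "\<nu> \<in> PiE {1..n} (\<lambda>_. {- pi..3 * pi})"
      using a by (auto simp: alcove_def PiE_iff)
  qed
  then have "emeasure (leb n) (chamber n) \<le> emeasure (leb n) (PiE {1..n} (\<lambda>_. {- pi..3 * pi}))"
    by (rule emeasure_mono) (auto simp: leb_def intro!: sets_PiM_I_finite)
  also have "\<dots> < \<infinity>"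
    unfolding emeasure_leb_box by (simp add: ennreal_prod_eq_top less_top[symmetric] power_eq_top_ennreal)
  finally show ?thesis .
qed

text \<open>
  The chamber contains the box of side \<open>\<pi> / 2n\<close> with its lowest corner at the equally spaced
  configuration \<open>\<nu>\<^sub>i = 2 \<pi> (n - i) / n\<close>.
\<close>

lemma chamber_positive_measure:
  assumes "n \<ge> 1"
  shows "emeasure (leb n) (chamber n) > 0"
proof -
  define d where "d = pi / real n"
  have d: "d > 0" "real n * d = pi"
    using assms by (simp_all add: d_def)
  \<comment> \<open>The sides have length \<open>d / 2\<close> rather than \<open>d\<close> to keep \<open>\<nu>\<^sub>n < \<pi>\<close> also for \<open>n = 1\<close>.\<close>
  define B where "B = PiE {1..n} (\<lambda>i. {2 * (real n - real i) * d..2 * (real n - real i) * d + d / 2})"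
  have "B \<subseteq> chamber n"
  proof
    fix \<nu> assume \<nu>: "\<nu> \<in> B"
    then have bd: "2 * (real n - real i) * d \<le> \<nu> i" "\<nu> i \<le> 2 * (real n - real i) * d + d / 2" if "i \<in> {1..n}" for i
      using that by (auto simp: B_def PiE_iff)
    have "\<nu> (Suc i) < \<nu> i" if "i \<in> {1..<n}" for i
      using bd(2)[of "Suc i"] bd(1)[of i] that d(1) by (simp add: algebra_simps)
    moreover have "\<nu> 1 < \<nu> n + 2 * pi"
      using bd(2)[of 1] bd(1)[of n] assms d by (simp add: algebra_simps)
    moreover have "- pi \<le> \<nu> n \<and> \<nu> n < pi"
    proof -
      have "d \<le> pi"
        using d assms mult_right_mono[of 1 "real n" d] by simp
      then show ?thesis
        using bd[of n] assms d(1) pi_gt_zero by simp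
    qed
    moreover have "\<nu> \<in> RR n"
      using \<nu> by (auto simp: B_def PiE_iff)
    ultimately show "\<nu> \<in> chamber n"
      by (simp add: chamber_def alcove_def)
  qed
  then have "emeasure (leb n) B \<le> emeasure (leb n) (chamber n)"
    using chamber_sets[OF assms] by (rule emeasure_mono)
  moreover have "emeasure (leb n) B > 0"
  proof -
    have "emeasure (leb n) B = ennreal (d / 2) ^ n"
      unfolding B_def emeasure_leb_box using d(1) by simp
    also have "\<dots> = ennreal ((d / 2) ^ n)"
      using d(1) by (intro ennreal_power) simp
    finally show ?thesis
      using d(1) by simp
  qed
  ultimately show ?thesis
    by (rule order_less_le_trans[rotated])
qed

lemma set_integrable_bounded_on_chamber:
  fixes f :: "(nat \<Rightarrow> real) \<Rightarrow> 'a :: {banach, second_countable_topology}"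
  assumes "n \<ge> 1" "f \<in> borel_measurable (leb n)" "\<And>\<nu>. \<nu> \<in> chamber n \<Longrightarrow> norm (f \<nu>) \<le> B"
  shows "set_integrable (leb n) (chamber n) f"
  unfolding set_integrable_def
proof (rule integrableI_bounded_set[where A = "chamber n" and B = B])
  show "AE x in leb n. x \<in> chamber n \<longrightarrow> norm (indicator (chamber n) x *\<^sub>R f x) \<le> B"
    using assms(3) by (intro AE_I2) auto
  show "(\<lambda>x. indicator (chamber n) x *\<^sub>R f x) \<in> borel_measurable (leb n)"
    using assms(2) chamber_sets[OF assms(1)] by (intro borel_measurable_scaleR borel_measurable_indicator)
qed (use chamber_sets chamber_finite_measure assms in auto)

lemma limit_mass_pos:
  assumes "n \<ge> 1"
  shows "limit_mass n > 0"
proof -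
  let ?f = "\<lambda>\<nu>. indicator (chamber n) \<nu> *\<^sub>R vandermonde_abs n \<nu>"
  have pos: "vandermonde_abs n \<nu> > 0" if "\<nu> \<in> chamber n" for \<nu>
    using vandermonde_abs_pos that by (auto simp: chamber_def)
  have int: "integrable (leb n) ?f"
    using set_integrable_bounded_on_chamber[OF assms vandermonde_abs_measurable, of "\<Prod>j<n. \<Prod>i<j. 2"]
      pos vandermonde_abs_le[of n] by (auto simp: set_integrable_def less_imp_le abs_of_pos)
  have nonneg: "?f \<nu> \<ge> 0" for \<nu>
    using pos by (auto simp: indicator_def less_imp_le)
  have "limit_mass n \<noteq> 0"
  proof
    assume "limit_mass n = 0"
    then have "AE \<nu> in leb n. ?f \<nu> = 0"
      using integral_nonneg_eq_0_iff_AE[OF int] nonneg by (simp add: limit_mass_def set_lebesgue_integral_def)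
    then have "AE \<nu> in leb n. \<nu> \<notin> chamber n"
      by (rule AE_mp) (use pos in \<open>force intro!: AE_I2 simp: indicator_def\<close>)
    then have "emeasure (leb n) (chamber n) = 0"
      using chamber_sets[OF assms] by (simp add: AE_iff_measurable[of "chamber n"] sets.sets_into_space Collect_conj_eq Int_absorb1)
    then show False
      using chamber_positive_measure[OF assms] by simp
  qed
  moreover have "limit_mass n \<ge> 0"
    unfolding limit_mass_def set_lebesgue_integral_def using nonneg by (intro integral_nonneg_AE AE_I2)
  ultimately show ?thesis
    by linarith
qed

lemma tendsto_of_linear_bound:
  fixes f :: "real \<Rightarrow> complex"
  assumes "\<And>r. 0 < r \<Longrightarrow> r \<le> e \<Longrightarrow> norm (f r - l) \<le> C * r" "e > 0"
  shows "(f \<longlongrightarrow> l) (at_right 0)"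
proof -
  have "((\<lambda>r. f r - l) \<longlongrightarrow> 0) (at_right 0)"
  proof (rule Lim_null_comparison)
    show "\<forall>\<^sub>F r in at_right 0. norm (f r - l) \<le> C * r"
      using eventually_at_right_real[OF assms(2)] by (rule eventually_mono) (use assms(1) in auto)
    show "((\<lambda>r. C * r) \<longlongrightarrow> 0) (at_right 0)"
      by (rule tendsto_mult_right_zero[OF tendsto_ident_at])
  qed
  then show ?thesis
    by (simp add: Lim_null[symmetric])
qed

theorem proposition5p5:
  fixes n :: nat and \<theta> \<nu> :: "nat \<Rightarrow> real"
  assumes "n \<ge> 1" and "\<theta> \<in> chamber n" and "\<nu> \<in> chamber n"
  shows "((\<lambda>r. H_normalised n r \<theta> \<nu>) \<longlongrightarrow>
           complex_of_real (1 / limit_mass n * vandermonde_abs n \<nu>)) (at_right 0) \<and>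
         ((\<lambda>r. mass n r \<theta> / complex_of_real (leading_factor n r \<theta>)) \<longlongrightarrow>
           complex_of_real (limit_mass n)) (at_right 0)"
proof
  have sub: "chamber n \<subseteq> alcove n"
    by (auto simp: chamber_def)
  then have \<theta>: "\<theta> \<in> alcove n" and \<nu>: "\<nu> \<in> alcove n"
    using assms by auto
  obtain C where C: "C \<ge> 0" and bound: "\<And>r \<nu>. 0 < r \<Longrightarrow> r \<le> exp (- 1) \<Longrightarrow> \<nu> \<in> alcove n \<Longrightarrow>
      cmod (H n r \<theta> \<nu> / of_real (leading_factor n r \<theta>) - of_real (vandermonde_abs n \<nu>)) \<le> C * r"
    by (rule H_asymptotics[OF \<theta>], rule that)
  let ?lf = "\<lambda>r. complex_of_real (leading_factor n r \<theta>)"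
  have lf: "?lf r \<noteq> 0" for r
    using leading_factor_pos[OF \<theta>, of r] by simp
  have point: "((\<lambda>r. H n r \<theta> \<nu> / ?lf r) \<longlongrightarrow> of_real (vandermonde_abs n \<nu>)) (at_right 0)"
    by (rule tendsto_of_linear_bound[where e = "exp (- 1)" and C = C]) (use bound \<nu> in auto)
  let ?V = "\<lambda>\<nu>. complex_of_real (vandermonde_abs n \<nu>)"
  define m where "m = measure (leb n) (chamber n)"
  have intV: "set_integrable (leb n) (chamber n) ?V"
  proof (rule set_integrable_bounded_on_chamber[OF assms(1)])
    show "?V \<in> borel_measurable (leb n)"
      by (rule measurable_compose[OF vandermonde_abs_measurable]) simp
    show "norm (?V \<nu>) \<le> (\<Prod>j<n. \<Prod>i<j. 2)" if "\<nu> \<in> chamber n" for \<nu>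
    proof -
      have "norm (?V \<nu>) = vandermonde_abs n \<nu>"
        unfolding norm_of_real using vandermonde_abs_pos[of \<nu> n] that sub by (intro abs_of_pos) blast
      then show ?thesis
        using vandermonde_abs_le[of n \<nu>] by linarith
    qed
  qed
  show mass: "((\<lambda>r. mass n r \<theta> / ?lf r) \<longlongrightarrow> of_real (limit_mass n)) (at_right 0)"
  proof (rule tendsto_of_linear_bound[where e = "exp (- 1)" and C = "C * m"])
    fix r :: real assume r: "0 < r" "r \<le> exp (- 1)"
    moreover have "exp (- 1 :: real) < 1"
      by simp
    ultimately have "r < 1"
      by linarith
    let ?F = "\<lambda>\<nu>. H n r \<theta> \<nu> / ?lf r"
    note [measurable] = H_measurable[OF r(1) \<open>r < 1\<close>] vandermonde_abs_measurable
    have meas: "(\<lambda>\<nu>. ?F \<nu> - ?V \<nu>) \<in> borel_measurable (leb n)"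
      by measurable
    have intD: "set_integrable (leb n) (chamber n) (\<lambda>\<nu>. ?F \<nu> - ?V \<nu>)"
      by (rule set_integrable_bounded_on_chamber[OF assms(1) meas]) (use bound[OF r] sub in blast)
    have "(LINT \<nu>:chamber n|leb n. ?F \<nu>) = (LINT \<nu>:chamber n|leb n. (?F \<nu> - ?V \<nu>) + ?V \<nu>)"
      by simp
    also have "\<dots> = (LINT \<nu>:chamber n|leb n. ?F \<nu> - ?V \<nu>) + (LINT \<nu>:chamber n|leb n. ?V \<nu>)"
      by (rule set_integral_add[OF intD intV])
    also have "(LINT \<nu>:chamber n|leb n. ?F \<nu>) = mass n r \<theta> / ?lf r"
      unfolding mass_def by (rule set_integral_divide_zero)
    also have "(LINT \<nu>:chamber n|leb n. ?V \<nu>) = of_real (limit_mass n)"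
      unfolding limit_mass_def by (rule set_integral_complex_of_real)
    finally have "mass n r \<theta> / ?lf r - of_real (limit_mass n) = (LINT \<nu>:chamber n|leb n. ?F \<nu> - ?V \<nu>)"
      by simp
    also have "norm \<dots> \<le> (LINT \<nu>|leb n. norm (indicator (chamber n) \<nu> *\<^sub>R (?F \<nu> - ?V \<nu>)))"
      unfolding set_lebesgue_integral_def by (rule integral_norm_bound)
    also have "\<dots> \<le> (LINT \<nu>|leb n. indicator (chamber n) \<nu> *\<^sub>R (C * r))"
    proof (rule integral_mono)
      show "integrable (leb n) (\<lambda>\<nu>. norm (indicator (chamber n) \<nu> *\<^sub>R (?F \<nu> - ?V \<nu>)))"
        using intD unfolding set_integrable_def by (rule integrable_norm)
      show "integrable (leb n) (\<lambda>\<nu>. indicator (chamber n) \<nu> *\<^sub>R (C * r))"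
        using chamber_sets chamber_finite_measure assms(1) by (intro integrable_scaleR_left integrable_real_indicator) auto
      show "norm (indicator (chamber n) \<nu> *\<^sub>R (?F \<nu> - ?V \<nu>)) \<le> indicator (chamber n) \<nu> *\<^sub>R (C * r)" for \<nu>
        using bound[OF r, of \<nu>] sub by (auto simp: indicator_def)
    qed
    also have "\<dots> = C * m * r"
      using chamber_sets[OF assms(1)] by (simp add: m_def sets.sets_into_space Int_absorb2)
    finally show "norm (mass n r \<theta> / ?lf r - of_real (limit_mass n)) \<le> C * m * r" .
  qed simp
  have "((\<lambda>r. (H n r \<theta> \<nu> / ?lf r) / (mass n r \<theta> / ?lf r)) \<longlongrightarrow> ?V \<nu> / of_real (limit_mass n)) (at_right 0)"
    using limit_mass_pos[OF assms(1)] by (intro tendsto_divide point mass) auto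
  then show "((\<lambda>r. H_normalised n r \<theta> \<nu>) \<longlongrightarrow> of_real (1 / limit_mass n * vandermonde_abs n \<nu>)) (at_right 0)"
    using lf by (simp add: H_normalised_def)
qed

end
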